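(* Let $G$ be a non-bipartite Eulerian graph of genus $g$ with $m$ edges, $T$ a spanning tree of $G$, $\gamma_T$ the canonical element in $M_2(E^c(T))$, and $H$ a subgroup of $\operatorname{Aut}(G)$. Let $S_1\sqcup S_2$ be any partition of $M_2(E^c(T))$ such that for every $\gamma\in M_2(E^c(T))$, $\gamma\ne\gamma+\gamma_T$, and if $\gamma\in S_1$ then $\gamma+\gamma_T\in S_2$. Then for $i=1,2$ (with $\gamma$ any representative of the class $[\gamma]$): $$\operatorname{ec}(G)=\frac{1}{m 2^{g-1}}\sum_{[\gamma]\in S_i/H}|[\gamma]|(-1)^{\sigma(\gamma)}\operatorname{trace}(W_{1,\gamma}^m)=\frac{1}{m 2^{g-1}}\sum_{[\gamma]\in S_i/H}|[\gamma]|(-1)^{\sigma(\gamma)}\operatorname{trace}(A_\gamma^m)$$ $$=\frac{1}{m 2^{g}}\sum_{[\gamma]\in M_2(E^c(T))/\langle H,\gamma_T\rangle}|[\gamma]|(-1)^{\sigma(\gamma)}\operatorname{trace}(W_{1,\gamma}^m)=\frac{1}{m 2^{g}}\sum_{[\gamma]\in M_2(E^c(T))/\langle H,\gamma_T\rangle}|[\gamma]|(-1)^{\sigma(\gamma)}\operatorname{trace}(A_\gamma^m)$$ $$=\frac{1}{m 2^{g-1}}\sum_{[\gamma]\in S_i/\langle H,\gamma_T\rangle}|[\gamma]|(-1)^{\sigma(\gamma)}\operatorname{trace}(W_{1,\gamma}^m)=\frac{1}{m 2^{g-1}}\sum_{[\gamma]\in S_i/\langle H,\gamma_T\rangle}|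[\gamma]|(-1)^{\sigma(\gamma)}\operatorname{trace}(A_\gamma^m).$$
   Context: A graph is connected and finite, loops and multiple edges allowed, vertices $v_1,\dots,v_n$, edges $e_1,\dots,e_m$, genus $g=m-n+1$. Each edge gives two mutually inverse oriented edges; $\mathbf e(0),\mathbf e(1)$ are initial/terminal vertices; $\mathbf E(G)$ is the set of $2m$ oriented edges. An Eulerian circuit is a closed walk (sequence of oriented edges, each starting where the previous ends, ending where it started) traversing each edge exactly once; $G$ is Eulerian if it has one; $\operatorname{ec}(G)$ is the number of Eulerian circuits up to cyclic rotation (a circuit and its reversal are distinct). $C_1(G,\mathbb Z/2\mathbb Z)$ is the $\mathbb Z/2\mathbb Z$-vector space with basis the edges; for $\gamma=\sum c_e e$ and an oriented edge $\mathbf e$ with underlying edge $e$, $\chi_\gamma(\mathbf e)=(-1)^{c_e}$. $E^c(T)$ is the set of edges not in $T$, $M_2(E^c(T))$ the subspace spanned by them, and $\sigma(\gamma)=\sum c_e$. The canonical element $\gamma_T\in M_2(E^c(T))$ has $c_e=0$ if the unique path in $T$ joining the endpoints of $e$ has odd length, and $c_e=1$ otherwise. $A_\gamma$: $n\times n$ with $(i,j)$ entry $\sum\chi_\gamma(\mathbf e)$ over oriented edges from $v_i$ to $v_j$. $\mathbf e$ feeds into $\mathbf e'$ if $\mathbf e'\ne\mathbf e^{-1}$ and $\mathbf e(1)=\mathbf e'(0)$; $W_{1,\gamma}$: $2m\times 2m$ indexed by $\mathbf E(G)$ with $(\mathbf e,\mathbf e')$ entry $\chi_\gamma(\mathbf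 e)$ if $\mathbf e$ feeds into $\mathbf e'$, else $0$. An automorphism $\tau\in\operatorname{Aut}(G)$ is a pair of incidence-preserving permutations of vertices and edges; it acts on $C_1(G,\mathbb Z/2\mathbb Z)$ by $\tau(\sum c_e e)=\sum c_e\tau(e)$. $\langle H,\gamma_T\rangle$ is the permutation group of $C_1(G,\mathbb Z/2\mathbb Z)$ generated by the actions of elements of $H$ and the translation $\gamma\mapsto\gamma+\gamma_T$. For a group $K$ of permutations of $C_1(G,\mathbb Z/2\mathbb Z)$ (namely $H$ or $\langle H,\gamma_T\rangle$), a subset $S$ and $\gamma\in S$, $[\gamma]=\{\tau(\gamma)\in S:\tau\in K\}$ and $S/K=\{[\gamma]:\gamma\in S\}$.
   Formalization: The condition "if γ∈S_1 then γ+γ_T∈S_2" is read as "γ∈S_1 if and only if γ+γ_T∈S_2"; with the one-way condition the claim fails, e.g. for two loops at one vertex with S_1={e_1}, where the S_1 sum is 0 but ec(G)=4. *)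

theory Defs
  imports
    "HOL-Analysis.Analysis"
    "HOL-Algebra.Bij"
    "HOL-Algebra.Generated_Groups"
    "HOL-Library.Z2"
    "Graph_Theory.Graph_Theory"
begin

section \<open>Finite multigraphs\<close>

text \<open>
  The vertex set and the edge set of a graph are the (finite) types \<open>'v\<close> and \<open>'e\<close>; a graph maps
  each edge to its two endpoints, so loops and multiple edges are allowed.  The order of the pair
  is an arbitrary reference direction, used only to name the two oriented edges
  \<open>(e, True)\<close> and \<open>(e, False)\<close> over \<open>e\<close>; they are distinct even if \<open>e\<close> is a loop.
\<close>

type_synonym ('v, 'e) multigraph = "'e \<Rightarrow> 'v \<times> 'v"

type_synonym 'e oriented = "'e \<times> bool"

definition initial :: "('v, 'e) multigraph \<Rightarrow> 'e oriented \<Rightarrow> 'v" where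
  "initial G a = (if snd a then fst (G (fst a)) else snd (G (fst a)))"

definition terminal :: "('v, 'e) multigraph \<Rightarrow> 'e oriented \<Rightarrow> 'v" where
  "terminal G a = (if snd a then snd (G (fst a)) else fst (G (fst a)))"

definition inverse_edge :: "'e oriented \<Rightarrow> 'e oriented" where
  "inverse_edge a = (fst a, \<not> snd a)"

definition endpoints :: "('v, 'e) multigraph \<Rightarrow> 'e \<Rightarrow> 'v set" where
  "endpoints G e = {fst (G e), snd (G e)}"

text \<open>
  The spanning subgraph with edge set \<open>F\<close>, as a digraph containing both orientations of each
  edge in \<open>F\<close>.  Its directed walks are the walks of the undirected graph, and its strong
  connectivity is the connectivity of the undirected graph.
\<close>

definition oriented_digraph ::
    "('v, 'e) multigraph \<Rightarrow> 'e set \<Rightarrow> ('v, 'e oriented) pre_digraph" where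
  "oriented_digraph G F =
     \<lparr>verts = UNIV, arcs = F \<times> UNIV, tail = initial G, head = terminal G\<rparr>"

definition connected_on :: "('v, 'e) multigraph \<Rightarrow> 'e set \<Rightarrow> bool" where
  "connected_on G F \<longleftrightarrow> strongly_connected (oriented_digraph G F)"

text \<open>
  A cycle of the undirected graph has distinct vertices and uses no edge twice; the second
  condition excludes an edge followed by its inverse.
\<close>

definition acyclic_on :: "('v, 'e) multigraph \<Rightarrow> 'e set \<Rightarrow> bool" where
  "acyclic_on G F \<longleftrightarrow>
     \<not> (\<exists>p. pre_digraph.cycle (oriented_digraph G F) p \<and> distinct (map fst p))"

definition is_spanning_tree :: "('v, 'e) multigraph \<Rightarrow> 'e set \<Rightarrow> bool" where
  "is_spanning_tree G T \<longleftrightarrow> connected_on G T \<and> acyclic_on G T"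

definition is_bipartite :: "('v, 'e) multigraph \<Rightarrow> bool" where
  "is_bipartite G \<longleftrightarrow> (\<exists>X. \<forall>e. (fst (G e) \<in> X) \<noteq> (snd (G e) \<in> X))"

definition genus :: "('v::finite, 'e::finite) multigraph \<Rightarrow> int" where
  "genus G = int CARD('e) - int CARD('v) + 1"


section \<open>Eulerian circuits\<close>

definition eulerian_circuit :: "('v, 'e) multigraph \<Rightarrow> 'e oriented list \<Rightarrow> bool" where
  "eulerian_circuit G p \<longleftrightarrow>
     (\<exists>u. pre_digraph.awalk (oriented_digraph G UNIV) u p u) \<and>
     (\<forall>e. count_list (map fst p) e = 1)"

definition is_eulerian :: "('v, 'e) multigraph \<Rightarrow> bool" where
  "is_eulerian G \<longleftrightarrow> (\<exists>p. eulerian_circuit G p)"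

definition rotation_rel :: "('v, 'e) multigraph \<Rightarrow> ('e oriented list \<times> 'e oriented list) set" where
  "rotation_rel G =
     {(p, q). eulerian_circuit G p \<and> eulerian_circuit G q \<and> (\<exists>k. q = rotate k p)}"

definition ec :: "('v, 'e) multigraph \<Rightarrow> nat" where
  "ec G = card ({p. eulerian_circuit G p} // rotation_rel G)"


section \<open>Chains modulo two\<close>

text \<open>
  The space of 1-chains modulo 2 is \<open>bit ^ 'e\<close>, with the edge \<open>e\<close> as the basis vector
  \<open>axis e 1\<close>.
\<close>

definition M2 :: "'e set \<Rightarrow> (bit ^ 'e::finite) set" where
  "M2 F = vec.span ((\<lambda>e. axis e 1) ` F)"

text \<open>\<open>minus_one_to c\<close> is \<open>(-1) ^ c\<close> for \<open>c\<close> in the field with two elements.\<close>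

definition minus_one_to :: "bit \<Rightarrow> real" where
  "minus_one_to c = (if c = 0 then 1 else - 1)"

definition chi :: "bit ^ 'e \<Rightarrow> 'e::finite oriented \<Rightarrow> real" where
  "chi \<gamma> a = minus_one_to (\<gamma> $ fst a)"

definition sigma :: "bit ^ 'e::finite \<Rightarrow> bit" where
  "sigma \<gamma> = (\<Sum>e\<in>UNIV. \<gamma> $ e)"

definition tree_path ::
    "('v, 'e) multigraph \<Rightarrow> 'e set \<Rightarrow> 'v \<Rightarrow> 'v \<Rightarrow> 'e oriented list" where
  "tree_path G T u v = (THE p. pre_digraph.apath (oriented_digraph G T) u p v)"

definition canonical :: "('v, 'e::finite) multigraph \<Rightarrow> 'e set \<Rightarrow> bit ^ 'e" where
  "canonical G T =
     (\<chi> e. if e \<in> T \<or> odd (length (tree_path G T (fst (G e)) (snd (G e)))) then 0 else 1)"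


section \<open>Twisted adjacency matrices\<close>

definition A_mat :: "('v::finite, 'e::finite) multigraph \<Rightarrow> bit ^ 'e \<Rightarrow> real ^ 'v ^ 'v" where
  "A_mat G \<gamma> = (\<chi> i j. \<Sum>a | initial G a = i \<and> terminal G a = j. chi \<gamma> a)"

definition feeds_into :: "('v, 'e) multigraph \<Rightarrow> 'e oriented \<Rightarrow> 'e oriented \<Rightarrow> bool" where
  "feeds_into G a b \<longleftrightarrow> b \<noteq> inverse_edge a \<and> terminal G a = initial G b"

definition W1_mat ::
    "('v, 'e::finite) multigraph \<Rightarrow> bit ^ 'e \<Rightarrow> real ^ ('e oriented) ^ ('e oriented)" where
  "W1_mat G \<gamma> = (\<chi> a b. if feeds_into G a b then chi \<gamma> a else 0)"

primrec mat_power :: "'a::semiring_1 ^ 'n::finite ^ 'n \<Rightarrow> nat \<Rightarrow> 'a ^ 'n ^ 'n" where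
  "mat_power M 0 = mat 1"
| "mat_power M (Suc k) = M ** mat_power M k"


section \<open>Automorphisms and permutation groups of chains\<close>

definition Aut :: "('v, 'e) multigraph \<Rightarrow> (('v \<Rightarrow> 'v) \<times> ('e \<Rightarrow> 'e)) monoid" where
  "Aut G = (BijGroup UNIV \<times>\<times> BijGroup UNIV)
     \<lparr>carrier := {(f, h). bij f \<and> bij h \<and> (\<forall>e. endpoints G (h e) = f ` endpoints G e)}\<rparr>"

definition chain_action :: "('v \<Rightarrow> 'v) \<times> ('e \<Rightarrow> 'e) \<Rightarrow> bit ^ 'e \<Rightarrow> bit ^ 'e::finite" where
  "chain_action \<tau> \<gamma> = (\<Sum>e\<in>UNIV. \<gamma> $ e *s axis (snd \<tau> e) 1)"

text \<open>
  \<open>perm_group H\<close> and \<open>perm_group_ext H \<delta>\<close> are sets of permutations of the whole chain space: the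
  group through which \<open>H\<close> acts, and the group generated by it and the translation by \<open>\<delta>\<close>.
\<close>

definition perm_group ::
    "(('v \<Rightarrow> 'v) \<times> ('e \<Rightarrow> 'e)) set \<Rightarrow> (bit ^ 'e \<Rightarrow> bit ^ 'e::finite) set" where
  "perm_group H = chain_action ` H"

definition perm_group_ext ::
    "(('v \<Rightarrow> 'v) \<times> ('e \<Rightarrow> 'e)) set \<Rightarrow> bit ^ 'e \<Rightarrow> (bit ^ 'e \<Rightarrow> bit ^ 'e::finite) set" where
  "perm_group_ext H \<delta> = generate (BijGroup UNIV) (insert (\<lambda>\<gamma>. \<gamma> + \<delta>) (perm_group H))"

text \<open>\<open>S\<close> need not be invariant under \<open>K\<close>: a class is the part of an orbit that lies in \<open>S\<close>.\<close>

definition orbit_class :: "('a \<Rightarrow> 'a) set \<Rightarrow> 'a set \<Rightarrow> 'a \<Rightarrow> 'a set" where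
  "orbit_class K S \<gamma> = {\<tau> \<gamma> |\<tau>. \<tau> \<in> K \<and> \<tau> \<gamma> \<in> S}"

definition orbit_classes :: "'a set \<Rightarrow> ('a \<Rightarrow> 'a) set \<Rightarrow> 'a set set" where
  "orbit_classes S K = orbit_class K S ` S"

text \<open>The function \<open>rep\<close> selects the representative at which each class is evaluated.\<close>

definition class_sum ::
    "((bit ^ 'e) set \<Rightarrow> bit ^ 'e) \<Rightarrow> (bit ^ 'e \<Rightarrow> real) \<Rightarrow> (bit ^ 'e::finite) set set \<Rightarrow> real" where
  "class_sum rep t Q = (\<Sum>c\<in>Q. real (card c) * minus_one_to (sigma (rep c)) * t (rep c))"

end

theory Submission
  imports Defs
begin

text \<open>
  Both traces count closed walks of length \<open>m\<close> weighted by products of signs: the adjacency matrix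
  factors through the oriented edges, so it can be replaced by the matrix of the relation ``ends
  where the next one starts'', of which \<open>W1_mat\<close> is the restriction to steps without backtracking.
  Summing the sign of \<open>\<gamma>\<close> times the weight of a walk over \<open>\<gamma> \<in> M2 (- T)\<close> gives
  \<open>2 ^ g\<close> if the walk uses every edge outside \<open>T\<close> an odd number of times, and \<open>0\<close> otherwise.  A closed
  walk and an Eulerian circuit both meet each fundamental cut of \<open>T\<close> evenly, so such a walk is also odd
  on the tree edges; having length \<open>m\<close>, it is an Eulerian circuit, and it cannot backtrack.  Each
  circuit is counted once for each of its \<open>m\<close> rotations.

  The summand is invariant under automorphisms and under adding \<open>canonical G T\<close>, which is the sum of
  all edges plus a coboundary.  Hence sums over classes are sums over elements, and \<open>S 1\<close> and \<open>S 2\<close>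
  each contribute half.
\<close>

section \<open>Traces as sums over closed walks\<close>

text \<open>By default the simplifier turns addition in \<open>bit\<close> into \<open>xor\<close> and loses the ring laws.\<close>

declare add_bit_eq_xor [simp del] mult_bit_eq_and [simp del]

text \<open>Generic in the relation, so that one walk count serves both \<open>feeds_into G\<close>
  and \<open>adjacent G\<close>.\<close>

definition step_mat ::
    "('e oriented \<Rightarrow> 'e oriented \<Rightarrow> bool) \<Rightarrow> bit ^ 'e \<Rightarrow> real ^ ('e::finite oriented) ^ ('e oriented)" where
  "step_mat R \<gamma> = (\<chi> a b. if R a b then chi \<gamma> a else 0)"

definition adjacent :: "('v, 'e) multigraph \<Rightarrow> 'e oriented \<Rightarrow> 'e oriented \<Rightarrow> bool" where
  "adjacent G a b \<longleftrightarrow> terminal G a = initial G b"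

text \<open>Repeating the first arc at the end encodes the closing step. Walks are rooted: the
  rotations of a circuit are separate elements.\<close>

definition closed_walks :: "('a \<Rightarrow> 'a \<Rightarrow> bool) \<Rightarrow> nat \<Rightarrow> 'a list set" where
  "closed_walks R k = {q. length q = k \<and> successively R (q @ [hd q])}"

definition chi_walk :: "bit ^ 'e \<Rightarrow> 'e::finite oriented list \<Rightarrow> real" where
  "chi_walk \<gamma> q = prod_list (map (chi \<gamma>) q)"

lemma finite_lists_length: "finite {q::'a::finite list. length q = k}"
  using finite_lists_length_eq[of "UNIV :: 'a set" k] by simp

lemma finite_closed_walks: "finite (closed_walks R k :: 'a::finite list set)"
  by (rule finite_subset[OF _ finite_lists_length[of k]]) (auto simp: closed_walks_def)

lemma sum_lists_Suc:
  fixes f :: "'a::finite list \<Rightarrow> real"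
  shows "(\<Sum>q | length q = Suc k. f q) = (\<Sum>a\<in>UNIV. \<Sum>q | length q = k. f (a # q))"
proof -
  have "(\<Sum>q | length q = Suc k. f q) = (\<Sum>(a, q)\<in>UNIV \<times> {q. length q = k}. f (a # q))"
    by (rule sum.reindex_bij_witness[of _ "\<lambda>(a, q). a # q" "\<lambda>q. (hd q, tl q)"])
      (auto simp: length_Suc_conv)
  then show ?thesis
    by (simp add: sum.cartesian_product)
qed

text \<open>Expanding the leftmost factor prepends an arc. An entry of \<open>step_mat\<close> is
  weighted by its row alone, so the last arc \<open>b\<close> contributes no sign.\<close>

lemma mat_power_step_mat:
  "mat_power (step_mat R \<gamma>) (Suc k) $ a $ b =
    (\<Sum>q | length q = k. if successively R (a # q @ [b]) then chi_walk \<gamma> (a # q) else 0)"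
proof (induction k arbitrary: a)
  case 0
  show ?case
    by (simp add: step_mat_def chi_walk_def)
next
  case (Suc k)
  have "mat_power (step_mat R \<gamma>) (Suc (Suc k)) $ a $ b =
      (\<Sum>c\<in>UNIV. step_mat R \<gamma> $ a $ c * mat_power (step_mat R \<gamma>) (Suc k) $ c $ b)"
    by (simp add: matrix_matrix_mult_def)
  also have "\<dots> = (\<Sum>c\<in>UNIV. \<Sum>q | length q = k.
      if successively R (a # (c # q) @ [b]) then chi_walk \<gamma> (a # c # q) else 0)"
    unfolding Suc.IH sum_distrib_left
    by (intro sum.cong refl) (auto simp: step_mat_def chi_walk_def)
  finally show ?case
    by (simp add: sum_lists_Suc)
qed

lemma trace_step_mat_power:
  assumes "k > 0"
  shows "trace (mat_power (step_mat R \<gamma>) k) = (\<Sum>q\<in>closed_walks R k. chi_walk \<gamma> q)"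
proof -
  obtain l where l: "k = Suc l"
    using assms gr0_implies_Suc by blast
  have "(\<Sum>q\<in>closed_walks R k. chi_walk \<gamma> q) =
      (\<Sum>q\<in>{q. length q = k}. if successively R (q @ [hd q]) then chi_walk \<gamma> q else 0)"
    by (rule sum.mono_neutral_cong_left) (auto simp: closed_walks_def finite_lists_length)
  then show ?thesis
    unfolding l trace_def mat_power_step_mat sum_lists_Suc by simp
qed

text \<open>
  The matrix \<open>A_mat\<close> is the product of the vertex-by-arc matrix of initial vertices and the
  arc-by-vertex matrix of weighted terminal vertices; the product in the other order is
  \<open>step_mat (adjacent G)\<close>.
\<close>

lemma trace_A_mat_power:
  fixes G :: "('v::finite, 'e::finite) multigraph"
  assumes "k > 0"
  shows "trace (mat_power (A_mat G \<gamma>) k) = trace (mat_power (step_mat (adjacent G) \<gamma>) k)"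
proof -
  define P :: "real ^ 'e oriented ^ 'v" where "P = (\<chi> v a. if initial G a = v then 1 else 0)"
  define Q :: "real ^ 'v ^ 'e oriented" where "Q = (\<chi> a v. if terminal G a = v then chi \<gamma> a else 0)"
  have PQ: "A_mat G \<gamma> = P ** Q"
    unfolding vec_eq_iff A_mat_def P_def Q_def matrix_matrix_mult_def
    by (auto simp: if_distrib[of "\<lambda>x. x * _"] sum.If_cases Int_def cong: if_cong intro!: sum.cong)
  have QP: "step_mat (adjacent G) \<gamma> = Q ** P"
    unfolding vec_eq_iff step_mat_def adjacent_def P_def Q_def matrix_matrix_mult_def
    by (auto simp: if_distrib[of "\<lambda>x. x * _"] cong: if_cong)
  \<comment> \<open>Regrouping leaves \<open>P\<close> in front and \<open>Q\<close> at the end;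
    cyclicity of the trace joins them into one more factor \<open>Q ** P\<close>.\<close>
  have pow: "mat_power (P ** Q) (Suc l) = P ** (mat_power (Q ** P) l ** Q)" for l
    by (induction l) (simp_all add: matrix_mul_assoc)
  have comm: "mat_power (Q ** P) l ** (Q ** P) = (Q ** P) ** mat_power (Q ** P) l" for l
    by (induction l) (simp_all add: matrix_mul_assoc[symmetric])
  obtain l where l: "k = Suc l"
    using assms gr0_implies_Suc by blast
  have "trace (mat_power (P ** Q) k) = trace (mat_power (Q ** P) l ** (Q ** P))"
    unfolding l pow by (subst trace_mul_sym) (simp add: matrix_mul_assoc)
  then show ?thesis
    unfolding PQ QP l comm by simp
qed

lemma W1_mat_eq_step_mat: "W1_mat G \<gamma> = step_mat (feeds_into G) \<gamma>"
  by (simp add: W1_mat_def step_mat_def)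

section \<open>Signs and edge multiplicities\<close>

lemma minus_one_to_0 [simp]: "minus_one_to 0 = 1"
  by (simp add: minus_one_to_def)

lemma minus_one_to_add: "minus_one_to (a + b) = minus_one_to a * minus_one_to b"
  by (cases a; cases b) (auto simp: minus_one_to_def)

lemma minus_one_to_1: "minus_one_to 1 = - 1"
  by (simp add: minus_one_to_def)

lemma minus_one_to_sum: "minus_one_to (\<Sum>x\<in>X. f x) = (\<Prod>x\<in>X. minus_one_to (f x))"
  by (induction X rule: infinite_finite_induct) (simp_all add: minus_one_to_add)

lemma prod_list_map_eq_prod_count:
  fixes f :: "'a::finite \<Rightarrow> 'b::comm_monoid_mult"
  shows "prod_list (map f xs) = (\<Prod>x\<in>UNIV. f x ^ count_list xs x)"
proof (induction xs)
  case (Cons y xs)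
  have "(\<Prod>x\<in>UNIV. f x ^ count_list (y # xs) x) =
      (\<Prod>x\<in>UNIV. (if x = y then f x else 1) * f x ^ count_list xs x)"
    by (rule prod.cong) auto
  with Cons show ?case
    by (simp add: prod.distrib)
qed simp

text \<open>
  A function \<open>d\<close> on the vertices encodes the cut between \<open>d = 0\<close> and \<open>d = 1\<close>, whose edges are those
  with coboundary \<open>1\<close>.
\<close>

definition coboundary :: "('v, 'e) multigraph \<Rightarrow> ('v \<Rightarrow> bit) \<Rightarrow> 'e \<Rightarrow> bit" where
  "coboundary G d e = d (fst (G e)) + d (snd (G e))"

lemma coboundary_ends: "coboundary G d (fst a) = d (initial G a) + d (terminal G a)"
  by (simp add: coboundary_def initial_def terminal_def add.commute)

lemma cas_oriented_digraph_simps [simp]: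
  "pre_digraph.cas (oriented_digraph G F) u [] v \<longleftrightarrow> u = v"
  "pre_digraph.cas (oriented_digraph G F) u (a # p) v \<longleftrightarrow>
    initial G a = u \<and> pre_digraph.cas (oriented_digraph G F) (terminal G a) p v"
  by (simp_all add: pre_digraph.cas.simps) (simp add: oriented_digraph_def)

text \<open>The sum telescopes: each inner vertex contributes its value twice, which is zero modulo
  2.\<close>

lemma sum_coboundary_walk:
  "pre_digraph.cas (oriented_digraph G F) u p v \<Longrightarrow>
    (\<Sum>a\<leftarrow>p. coboundary G d (fst a)) = d u + d v"
proof (induction p arbitrary: u)
  case (Cons a p)
  then have "(\<Sum>b\<leftarrow>a # p. coboundary G d (fst b)) =
      (d u + d (terminal G a)) + (d (terminal G a) + d v)"
    by (auto simp: coboundary_ends)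
  then show ?case
    by (cases "d (terminal G a)") (simp_all add: algebra_simps)
next
  case Nil
  then show ?case
    by (cases "d u") auto
qed

lemma cas_iff_successively:
  "pre_digraph.cas (oriented_digraph G F) u q (initial G b) \<longleftrightarrow>
    initial G (hd (q @ [b])) = u \<and> successively (adjacent G) (q @ [b])"
proof (induction q arbitrary: u)
  case (Cons a q)
  show ?case
    unfolding cas_oriented_digraph_simps Cons.IH
    by (simp add: successively_Cons adjacent_def) metis
qed auto

lemma sum_coboundary_closed_walk:
  assumes "q \<in> closed_walks (adjacent G) k"
  shows "(\<Sum>a\<leftarrow>q. coboundary G d (fst a)) = 0"
proof (cases q)
  case (Cons a r)
  then have "pre_digraph.cas (oriented_digraph G UNIV) (initial G a) q (initial G a)"
    using assms by (simp only: cas_iff_successively) (simp add: closed_walks_def)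
  then show ?thesis
    by (cases "d (initial G a)") (simp_all add: sum_coboundary_walk)
qed simp

lemma minus_one_to_sum_list: "minus_one_to (sum_list xs) = prod_list (map minus_one_to xs)"
  by (induction xs) (simp_all add: minus_one_to_add)

text \<open>A closed walk crosses a cut evenly. In product form this can be multiplied with walk
  weights.\<close>

lemma cut_crossings:
  fixes G :: "('v, 'e::finite) multigraph"
  assumes "q \<in> closed_walks (adjacent G) k"
  shows "(\<Prod>e\<in>UNIV. minus_one_to (coboundary G d e) ^ count_list (map fst q) e) = 1"
  using arg_cong[OF sum_coboundary_closed_walk[OF assms], of minus_one_to]
  by (simp add: minus_one_to_sum_list prod_list_map_eq_prod_count[symmetric] comp_def)

section \<open>Eulerian circuits as closed walks\<close>

lemma awalk_iff_successively:
  assumes "q \<noteq> []"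
  shows "(\<exists>u. pre_digraph.awalk (oriented_digraph G UNIV) u q u) \<longleftrightarrow>
    successively (adjacent G) (q @ [hd q])"
proof -
  have "(\<exists>u. pre_digraph.awalk (oriented_digraph G UNIV) u q u) \<longleftrightarrow>
      (\<exists>u. pre_digraph.cas (oriented_digraph G UNIV) u q u)"
    by (simp add: pre_digraph.awalk_def oriented_digraph_def)
  also have "\<dots> \<longleftrightarrow> pre_digraph.cas (oriented_digraph G UNIV) (initial G (hd q)) q (initial G (hd q))"
    using assms by (cases q) auto
  finally show ?thesis
    using assms by (simp add: cas_iff_successively)
qed

lemma sum_count_list_UNIV: "(\<Sum>e\<in>UNIV. count_list xs (e::'a::finite)) = length xs"
  by (rule sum_count_set) auto

lemma eulerian_circuit_iff:
  fixes G :: "('v, 'e::finite) multigraph"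
  shows "eulerian_circuit G q \<longleftrightarrow>
    q \<in> closed_walks (adjacent G) CARD('e) \<and> (\<forall>e. count_list (map fst q) e = 1)"
proof (cases "\<forall>e. count_list (map fst q) e = 1")
  case True
  then have "length q = CARD('e)"
    using sum_count_list_UNIV[of "map fst q"] by simp
  moreover from this have "q \<noteq> []"
    by auto
  ultimately show ?thesis
    using True by (simp add: eulerian_circuit_def closed_walks_def awalk_iff_successively)
qed (auto simp: eulerian_circuit_def)

lemma eulerian_circuit_distinct: "eulerian_circuit G q \<Longrightarrow> distinct (map fst q)"
proof -
  assume "eulerian_circuit G q"
  then have "count (mset (map fst q)) e = 1" for e
    unfolding count_mset by (simp add: eulerian_circuit_def)
  then show ?thesis
    unfolding distinct_count_atmost_1 by (metis count_eq_zero_iff set_mset_mset zero_neq_one)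
qed

section \<open>Spanning trees and cuts\<close>

lemma oriented_digraph_sel [simp]:
  "verts (oriented_digraph G F) = UNIV" "arcs (oriented_digraph G F) = F \<times> UNIV"
  "tail (oriented_digraph G F) = initial G" "head (oriented_digraph G F) = terminal G"
  by (simp_all add: oriented_digraph_def)

lemma wf_oriented_digraph: "wf_digraph (oriented_digraph G F)"
  by unfold_locales simp_all

lemma reachable_arc:
  assumes "u \<rightarrow>\<^sup>*\<^bsub>oriented_digraph G F\<^esub> initial G a" "fst a \<in> F"
  shows "u \<rightarrow>\<^sup>*\<^bsub>oriented_digraph G F\<^esub> terminal G a"
proof -
  interpret wf_digraph "oriented_digraph G F"
    by (rule wf_oriented_digraph)
  have "a \<in> arcs (oriented_digraph G F)"
    using assms(2) by (simp add: mem_Times_iff)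
  then have "initial G a \<rightarrow>\<^bsub>oriented_digraph G F\<^esub> terminal G a"
    using in_arcs_imp_in_arcs_ends[of a] by simp
  then show ?thesis
    using assms(1) by (metis reachable_adjI reachable_trans)
qed

lemma ends_in_awalk_verts:
  assumes "pre_digraph.apath (oriented_digraph G F) u p v" "b \<in> set p" "fst b = fst a"
  shows "initial G a \<in> set (pre_digraph.awalk_verts (oriented_digraph G F) u p)"
proof -
  interpret wf_digraph "oriented_digraph G F"
    by (rule wf_oriented_digraph)
  have "p \<noteq> []"
    using assms(2) by auto
  then have "set (awalk_verts u p) = initial G ` set p \<union> terminal G ` set p"
    using set_awalk_verts_not_Nil_cas[of u p v] assms(1) by (simp add: apath_def awalk_def)
  moreover have "initial G a = initial G b \<or> initial G a = terminal G b"
    using assms(3) by (auto simp: initial_def terminal_def)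
  ultimately show ?thesis
    using assms(2) by auto
qed

text \<open>Using the first edge again, in either direction, would return the path to its initial
  vertex.\<close>

lemma apath_distinct_edges:
  assumes "pre_digraph.apath (oriented_digraph G F) u p v"
  shows "distinct (map fst p)"
  using assms
proof (induction p arbitrary: u)
  case (Cons a p)
  interpret wf_digraph "oriented_digraph G F"
    by (rule wf_oriented_digraph)
  have p: "apath (terminal G a) p v" and a: "initial G a \<notin> set (awalk_verts (terminal G a) p)"
    using Cons.prems by (auto simp: apath_Cons_iff)
  have "fst b \<noteq> fst a" if "b \<in> set p" for b
    using ends_in_awalk_verts[OF p that, of a] a by blast
  then show ?case
    using Cons.IH[OF p] by force
qed simp

text \<open>A path back to the start of \<open>a\<close> avoiding its edge would close up with
  \<open>a\<close> to a cycle. The path may be empty, so loops are excluded too.\<close>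

lemma acyclic_on_bridge:
  assumes "acyclic_on G T" "fst a \<in> T"
  shows "\<not> terminal G a \<rightarrow>\<^sup>*\<^bsub>oriented_digraph G (T - {fst a})\<^esub> initial G a"
proof
  assume "terminal G a \<rightarrow>\<^sup>*\<^bsub>oriented_digraph G (T - {fst a})\<^esub> initial G a"
  then obtain p where p: "pre_digraph.apath (oriented_digraph G (T - {fst a})) (terminal G a) p (initial G a)"
    using wf_digraph.reachable_apath[OF wf_oriented_digraph] by metis
  then have cas: "pre_digraph.cas (oriented_digraph G (T - {fst a})) (terminal G a) p (initial G a)"
      "set p \<subseteq> (T - {fst a}) \<times> UNIV"
      "distinct (pre_digraph.awalk_verts (oriented_digraph G (T - {fst a})) (terminal G a) p)"
    by (auto simp: pre_digraph.apath_def pre_digraph.awalk_def)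
  \<comment> \<open>Neither the walk condition nor the vertex sequence mentions the edge set, so the
    path can be read in all of \<open>T\<close>.\<close>
  have cas': "pre_digraph.cas (oriented_digraph G T) u q w \<longleftrightarrow>
      pre_digraph.cas (oriented_digraph G (T - {fst a})) u q w" for u q w
    by (induction q arbitrary: u) simp_all
  have verts': "pre_digraph.awalk_verts (oriented_digraph G T) u q =
      pre_digraph.awalk_verts (oriented_digraph G (T - {fst a})) u q" for u q
    by (induction q arbitrary: u) (simp_all add: pre_digraph.awalk_verts.simps)
  have "pre_digraph.cycle (oriented_digraph G T) (a # p)"
    unfolding pre_digraph.cycle_def pre_digraph.awalk_def
    using cas assms(2)
    by (intro exI[of _ "initial G a"])
       (auto simp: cas' verts' pre_digraph.awalk_verts.simps mem_Times_iff)
  moreover have "distinct (map fst (a # p))"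
    using apath_distinct_edges[OF p] cas(2) by auto
  ultimately show False
    using assms(1) by (auto simp: acyclic_on_def)
qed

text \<open>The fundamental cut of \<open>e\<close>: \<open>d\<close> is the indicator of what
  \<open>snd (G e)\<close> reaches once \<open>e\<close> is deleted from \<open>T\<close>. By the
  bridge property \<open>e\<close> crosses this cut, and no other tree edge leaves the reachable
  set.\<close>

lemma acyclic_on_cut:
  fixes G :: "('v, 'e) multigraph"
  assumes "acyclic_on G T" "e \<in> T"
  obtains d where "\<And>e'. e' \<in> T \<Longrightarrow> coboundary G d e' = (if e' = e then 1 else 0)"
proof -
  let ?D = "oriented_digraph G (T - {e})"
  define d :: "'v \<Rightarrow> bit" where "d x = (if snd (G e) \<rightarrow>\<^sup>*\<^bsub>?D\<^esub> x then 1 else 0)" for x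
  have "coboundary G d e' = (if e' = e then 1 else 0)" if e': "e' \<in> T" for e'
  proof (cases "e' = e")
    case True
    have "\<not> snd (G e) \<rightarrow>\<^sup>*\<^bsub>?D\<^esub> fst (G e)"
      using acyclic_on_bridge[of G T "(e, True)"] assms by (simp add: initial_def terminal_def)
    moreover have "snd (G e) \<rightarrow>\<^sup>*\<^bsub>?D\<^esub> snd (G e)"
      by (simp add: wf_digraph.reachable_refl wf_oriented_digraph)
    ultimately show ?thesis
      using True by (simp add: coboundary_def d_def)
  next
    case False
    have "snd (G e) \<rightarrow>\<^sup>*\<^bsub>?D\<^esub> fst (G e') \<longleftrightarrow> snd (G e) \<rightarrow>\<^sup>*\<^bsub>?D\<^esub> snd (G e')"
      using reachable_arc[where a = "(e', True)" and G = G and F = "T - {e}" and u = "snd (G e)"]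
        reachable_arc[where a = "(e', False)" and G = G and F = "T - {e}" and u = "snd (G e)"] e' False
      by (auto simp: initial_def terminal_def)
    then show ?thesis
      using False by (simp add: coboundary_def d_def)
  qed
  then show ?thesis
    using that by blast
qed

lemma coboundary_add: "coboundary G (\<lambda>v. c v + d v) e = coboundary G c e + coboundary G d e"
  by (simp add: coboundary_def algebra_simps)

lemma coboundary_sum: "coboundary G (\<lambda>v. \<Sum>x\<in>X. d x v) e = (\<Sum>x\<in>X. coboundary G (d x) e)"
  by (simp add: coboundary_def sum.distrib)

text \<open>On \<open>T\<close> a fundamental cut contains only its own edge, so the cuts of the
  edges in \<open>X\<close> can be added up.\<close>

lemma acyclic_on_prescribed_coboundary:
  fixes G :: "('v, 'e::finite) multigraph"
  assumes "acyclic_on G T" "X \<subseteq> T"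
  obtains d where "\<And>e. e \<in> T \<Longrightarrow> coboundary G d e = (if e \<in> X then 1 else 0)"
proof -
  have "\<forall>x\<in>T. \<exists>d. \<forall>e\<in>T. coboundary G d e = (if e = x then 1 else 0)"
    using acyclic_on_cut[OF assms(1)] by metis
  then obtain c where c: "\<And>x e. x \<in> T \<Longrightarrow> e \<in> T \<Longrightarrow> coboundary G (c x) e = (if e = x then 1 else 0)"
    by metis
  have "coboundary G (\<lambda>v. \<Sum>x\<in>X. c x v) e = (\<Sum>x\<in>X. if e = x then 1 else 0)" if "e \<in> T" for e
    using c assms(2) that unfolding coboundary_sum by (intro sum.cong) auto
  then have "coboundary G (\<lambda>v. \<Sum>x\<in>X. c x v) e = (if e \<in> X then 1 else 0)" if "e \<in> T" for e
    using that by simp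
  then show ?thesis
    using that by blast
qed

lemma connected_on_coboundary_0:
  assumes "connected_on G T" and d: "\<And>e. e \<in> T \<Longrightarrow> coboundary G d e = 0"
  shows "d u = d v"
proof -
  interpret wf_digraph "oriented_digraph G T"
    by (rule wf_oriented_digraph)
  have "u \<rightarrow>\<^sup>*\<^bsub>oriented_digraph G T\<^esub> v"
    using assms(1) by (auto simp: connected_on_def strongly_connected_def)
  then obtain p where p: "awalk u p v"
    by (auto simp: reachable_awalk)
  then have "(\<Sum>a\<leftarrow>p. coboundary G d (fst a)) = (\<Sum>a\<leftarrow>p. 0)"
    using d by (intro arg_cong[of _ _ sum_list] map_cong) (auto simp: awalk_def)
  then have "d u + d v = 0"
    using p sum_coboundary_walk[of G T u p v d] by (simp add: awalk_def)
  then show ?thesis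
    by (cases "d u"; cases "d v") auto
qed

text \<open>
  For a spanning tree, a vertex function modulo 2 is determined, freely, by its value at one vertex
  and its coboundary on the tree.
\<close>

lemma card_spanning_tree:
  fixes G :: "('v::finite, 'e::finite) multigraph"
  assumes "is_spanning_tree G T"
  shows "CARD('v) = Suc (card T)"
proof -
  have con: "connected_on G T" and acy: "acyclic_on G T"
    using assms by (auto simp: is_spanning_tree_def)
  fix r :: 'v
  define \<Phi> :: "('v \<Rightarrow> bit) \<Rightarrow> bit \<times> 'e set" where "\<Phi> d = (d r, {e \<in> T. coboundary G d e = 1})" for d
  have "bij_betw \<Phi> UNIV (UNIV \<times> Pow T)"
  proof (rule bij_betw_imageI)
    show "inj \<Phi>"
    proof (rule injI, rule ext)
      fix c d v assume cd: "\<Phi> c = \<Phi> d"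
      \<comment> \<open>Modulo 2 the sum of \<open>c\<close> and \<open>d\<close> is also their
        difference; with zero coboundary on \<open>T\<close> it is constant, and it vanishes at
        \<open>r\<close>.\<close>
      have "coboundary G (\<lambda>v. c v + d v) e = 0" if "e \<in> T" for e
      proof -
        have "coboundary G c e = 1 \<longleftrightarrow> coboundary G d e = 1"
          using cd that by (auto simp: \<Phi>_def set_eq_iff)
        then show ?thesis
          unfolding coboundary_add
          by (cases "coboundary G c e"; cases "coboundary G d e") auto
      qed
      from connected_on_coboundary_0[OF con this, of v r] show "c v = d v"
        using cd by (cases "c v"; cases "d v"; cases "c r"; cases "d r") (auto simp: \<Phi>_def)
    qed
    have "(b, X) \<in> range \<Phi>" if X: "X \<subseteq> T" for b X
    proof -
      obtain d where d: "\<And>e. e \<in> T \<Longrightarrow> coboundary G d e = (if e \<in> X then 1 else 0)"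
        using acyclic_on_prescribed_coboundary[OF acy X] by metis
      \<comment> \<open>Adding a constant preserves the coboundary; this one moves the value at
        \<open>r\<close> to \<open>b\<close>.\<close>
      have "coboundary G (\<lambda>v. d v + (d r + b)) e = coboundary G d e" for e
        by (cases "d r + b") (simp_all add: coboundary_def algebra_simps)
      moreover have "d r + (d r + b) = b"
        by (cases "d r") (simp_all add: algebra_simps)
      ultimately have "(b, X) = \<Phi> (\<lambda>v. d v + (d r + b))"
        using d X by (auto simp: \<Phi>_def split: if_splits)
      then show ?thesis
        by blast
    qed
    then show "range \<Phi> = UNIV \<times> Pow T"
      by (auto simp: \<Phi>_def)
  qed
  then have "card (UNIV :: ('v \<Rightarrow> bit) set) = card ((UNIV :: bit set) \<times> Pow T)"
    by (rule bij_betw_same_card)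
  moreover have "card {0, 1 :: bit} = 2"
    by simp
  moreover have "(UNIV :: bit set) = {0, 1}"
    using bit.exhaust by blast
  \<comment> \<open>The pairs number \<open>2 * 2 ^ card T\<close>, one factor 2 coming from the
    value at \<open>r\<close>.\<close>
  ultimately have "(2::nat) ^ CARD('v) = 2 ^ Suc (card T)"
    by (simp add: card_fun card_cartesian_product card_Pow)
  then show ?thesis
    by (simp only: power_inject_exp)
qed

text \<open>The fundamental cut of the first edge of \<open>p\<close> separates \<open>u\<close>
  from \<open>v\<close>, so \<open>q\<close> must use that edge. Since \<open>q\<close> visits
  \<open>u\<close> only at its start, the edge comes first in \<open>q\<close> as well, and the
  remaining paths agree by induction.\<close>

lemma acyclic_on_apath_unique:
  assumes acy: "acyclic_on G T"
    and "pre_digraph.apath (oriented_digraph G T) u p v" "pre_digraph.apath (oriented_digraph G T) u q v"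
  shows "p = q"
  using assms(2,3)
proof (induction p arbitrary: u q)
  interpret wf_digraph "oriented_digraph G T"
    by (rule wf_oriented_digraph)
  {
    case Nil
    then show ?case
      using apath_nonempty_ends[of u q v] by (auto simp: apath_Nil_iff)
  next
    case (Cons a p)
    have p: "apath (terminal G a) p v" "initial G a = u" "fst a \<in> T" "u \<noteq> v"
        "u \<notin> set (awalk_verts (terminal G a) p)"
      using Cons.prems(1) apath_nonempty_ends[OF Cons.prems(1)] by (auto simp: apath_Cons_iff)
    then obtain b q' where q: "q = b # q'"
      using Cons.prems(2) by (cases q) (auto simp: apath_Nil_iff)
    have q': "apath (terminal G b) q' v" "initial G b = u" "fst b \<in> T"
        "u \<notin> set (awalk_verts (terminal G b) q')"
      using Cons.prems(2) unfolding q by (auto simp: apath_Cons_iff)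
    obtain d where d: "\<And>e. e \<in> T \<Longrightarrow> coboundary G d e = (if e = fst a then 1 else 0)"
      using acyclic_on_cut[OF acy p(3)] by metis
    have d_const: "d w = d v" if r: "apath w r v" and "fst a \<notin> fst ` set r" for w r
    proof -
      have "set r \<subseteq> T \<times> UNIV"
        using r by (simp add: apath_def awalk_def)
      then have "fst x \<in> T \<and> fst x \<noteq> fst a" if "x \<in> set r" for x
        using \<open>fst a \<notin> fst ` set r\<close> that imageI[OF that, of fst]
        by (metis mem_Times_iff subsetD)
      then have "(\<Sum>x\<leftarrow>r. coboundary G d (fst x)) = (\<Sum>x\<leftarrow>r. 0)"
        using d by (intro arg_cong[of _ _ sum_list] map_cong) auto
      moreover have "(\<Sum>x\<leftarrow>r. coboundary G d (fst x)) = d w + d v"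
        using r sum_coboundary_walk[of G T w r v d] by (simp add: apath_def awalk_def)
      ultimately show ?thesis
        by (cases "d w"; cases "d v") auto
    qed
    have dT: "d (terminal G a) = d v"
      using apath_distinct_edges[OF Cons.prems(1)] by (intro d_const[OF p(1)]) auto
    have dI: "d u \<noteq> d (terminal G a)"
      using d[OF p(3)] p(2) coboundary_ends[of G d a]
      by (cases "d u"; cases "d (terminal G a)") auto
    then have "fst a \<in> fst ` set q"
      using d_const[OF Cons.prems(2)] dT by metis
    moreover have "fst x \<noteq> fst a" if "x \<in> set q'" for x
      using ends_in_awalk_verts[OF q'(1) that, of a] q'(4) p(2) by blast
    ultimately have "fst a = fst b"
      unfolding q by force
    \<comment> \<open>The edge joins opposite sides of the cut, hence is no loop, and starting at
      \<open>u\<close> fixes its orientation.\<close>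
    moreover have "snd a = snd b"
      using dI p(2) q'(2) calculation by (auto simp: initial_def terminal_def split: if_splits)
    ultimately have "a = b"
      by (simp add: prod_eq_iff)
    then show ?case
      using Cons.IH[OF p(1)] q'(1) q by simp
  }
qed

text \<open>A tree has a proper two-colouring \<open>d\<close>. Telescoping along a tree path gives
  its length modulo 2 as the colour difference of its ends, so an edge has coefficient 0 exactly
  when \<open>d\<close> separates its ends.\<close>

lemma canonical_eq_coboundary:
  fixes G :: "('v, 'e::finite) multigraph"
  assumes "is_spanning_tree G T"
  obtains d where "\<And>e. canonical G T $ e = 1 + coboundary G d e"
proof -
  have con: "connected_on G T" and acy: "acyclic_on G T"
    using assms by (auto simp: is_spanning_tree_def)
  interpret wf_digraph "oriented_digraph G T"
    by (rule wf_oriented_digraph)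
  obtain d where d: "\<And>e. e \<in> T \<Longrightarrow> coboundary G d e = 1"
    using acyclic_on_prescribed_coboundary[OF acy subset_refl] by metis
  have "canonical G T $ e = 1 + coboundary G d e" for e
  proof (cases "e \<in> T")
    case True
    then show ?thesis
      by (simp add: canonical_def d)
  next
    case False
    define u v where "u = fst (G e)" and "v = snd (G e)"
    have "u \<rightarrow>\<^sup>*\<^bsub>oriented_digraph G T\<^esub> v"
      using con by (auto simp: connected_on_def strongly_connected_def)
    then obtain p where p: "apath u p v"
      using reachable_apath by auto
    then have path: "tree_path G T u v = p"
      unfolding tree_path_def by (rule the_equality) (metis acyclic_on_apath_unique acy p)
    have "(\<Sum>a\<leftarrow>p. coboundary G d (fst a)) = (\<Sum>a\<leftarrow>p. 1)"
      using d p by (intro arg_cong[of _ _ sum_list] map_cong) (auto simp: apath_def awalk_def)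
    then have "(\<Sum>a\<leftarrow>p. 1) = coboundary G d e"
      using p sum_coboundary_walk[of G T u p v d]
      by (simp add: apath_def awalk_def coboundary_def u_def v_def)
    moreover have "(\<Sum>a\<leftarrow>p. 1 :: bit) = (if odd (length p) then 1 else 0)"
      by (induction p) auto
    ultimately show ?thesis
      using False path by (auto simp: canonical_def u_def v_def)
  qed
  then show ?thesis
    using that by blast
qed

section \<open>Sums over chains and Eulerian circuits\<close>

lemma M2_eq: "M2 F = {\<gamma>. \<forall>e. e \<notin> F \<longrightarrow> \<gamma> $ e = 0}"
proof (intro equalityI subsetI)
  fix \<gamma> :: "bit ^ 'a" assume "\<gamma> \<in> M2 F"
  then show "\<gamma> \<in> {\<gamma>. \<forall>e. e \<notin> F \<longrightarrow> \<gamma> $ e = 0}"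
    unfolding M2_def
    by (induction rule: vec.span_induct_alt) (auto simp: axis_def split: if_splits)
next
  fix \<gamma> :: "bit ^ 'a" assume *: "\<gamma> \<in> {\<gamma>. \<forall>e. e \<notin> F \<longrightarrow> \<gamma> $ e = 0}"
  have "\<gamma> $ e *s axis e 1 \<in> M2 F" for e
  proof (cases "e \<in> F")
    case True
    then show ?thesis
      unfolding M2_def by (intro vec.span_scale vec.span_base imageI)
  next
    case False
    then show ?thesis
      using * vec.span_zero by (simp add: M2_def)
  qed
  then have "(\<Sum>e\<in>UNIV. \<gamma> $ e *s axis e 1) \<in> M2 F"
    unfolding M2_def by (intro vec.span_sum) auto
  then show "\<gamma> \<in> M2 F"
    by (simp add: basis_expansion)
qed

lemma bij_betw_M2: "bij_betw (\<lambda>\<gamma>. {e. \<gamma> $ e = 1}) (M2 F) (Pow F)"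
proof (rule bij_betw_byWitness[where f' = "\<lambda>X. \<chi> e. if e \<in> X then 1 else 0"])
  show "(\<lambda>\<gamma>. {e. \<gamma> $ e = 1}) ` M2 F \<subseteq> Pow F"
    by (auto simp: M2_eq)
qed (auto simp: M2_eq vec_eq_iff)

lemma finite_M2: "finite (M2 F)"
  using bij_betw_finite[OF bij_betw_M2[of F]] by simp

lemma card_M2: "card (M2 F) = 2 ^ card F"
  using bij_betw_same_card[OF bij_betw_M2[of F]] by (simp add: card_Pow)

lemma M2_add: "\<gamma> \<in> M2 F \<Longrightarrow> \<delta> \<in> M2 F \<Longrightarrow> \<gamma> + \<delta> \<in> M2 F"
  by (simp add: M2_eq)

lemma chain_add_self: "\<gamma> + \<delta> + \<delta> = (\<gamma> :: bit ^ 'e)"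
  unfolding vec_eq_iff vector_add_component
proof
  fix e
  show "\<gamma> $ e + \<delta> $ e + \<delta> $ e = \<gamma> $ e"
    by (cases "\<delta> $ e") (simp_all add: add.assoc)
qed

lemma sum_M2_shift:
  assumes "\<delta> \<in> M2 F"
  shows "(\<Sum>\<gamma>\<in>M2 F. f (\<gamma> + \<delta>)) = (\<Sum>\<gamma>\<in>M2 F. f \<gamma>)"
  by (rule sum.reindex_bij_witness[of _ "\<lambda>\<gamma>. \<gamma> + \<delta>" "\<lambda>\<gamma>. \<gamma> + \<delta>"])
     (auto simp: chain_add_self M2_add assms)

text \<open>The sign of \<open>sigma\<close> acts as one further passage over every edge. For a
  fixed walk this weight is a character of the group of chains.\<close>

definition walk_weight :: "bit ^ 'e \<Rightarrow> 'e::finite oriented list \<Rightarrow> real" where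
  "walk_weight \<gamma> q = minus_one_to (sigma \<gamma>) * chi_walk \<gamma> q"

lemma walk_weight_eq:
  "walk_weight \<gamma> q = (\<Prod>e\<in>UNIV. minus_one_to (\<gamma> $ e) ^ Suc (count_list (map fst q) e))"
proof -
  have "chi_walk \<gamma> q = prod_list (map (\<lambda>e. minus_one_to (\<gamma> $ e)) (map fst q))"
    by (simp add: chi_walk_def chi_def[abs_def] comp_def)
  then show ?thesis
    by (simp only: prod_list_map_eq_prod_count walk_weight_def sigma_def minus_one_to_sum
        power_Suc prod.distrib)
qed

lemma walk_weight_add: "walk_weight (\<gamma> + \<delta>) q = walk_weight \<gamma> q * walk_weight \<delta> q"
  by (simp only: walk_weight_eq vector_add_component minus_one_to_add power_mult_distrib prod.distrib)

lemma walk_weight_axis: "walk_weight (axis e 1) q = (- 1) ^ Suc (count_list (map fst q) e)"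
proof -
  have "walk_weight (axis e 1) q =
      (\<Prod>x\<in>UNIV. if x = e then (- 1) ^ Suc (count_list (map fst q) x) else 1)"
    unfolding walk_weight_eq by (rule prod.cong) (auto simp: axis_def minus_one_to_def)
  then show ?thesis
    by simp
qed

text \<open>Orthogonality of characters: the weight is trivial on \<open>M2 F\<close> if all
  multiplicities on \<open>F\<close> are odd; otherwise translation by an edge of even multiplicity,
  whose weight is -1, negates the sum.\<close>

lemma sum_walk_weight:
  "(\<Sum>\<gamma>\<in>M2 F. walk_weight \<gamma> q) =
    (if \<forall>e\<in>F. odd (count_list (map fst q) e) then 2 ^ card F else 0)"
proof (cases "\<forall>e\<in>F. odd (count_list (map fst q) e)")
  case True
  have "walk_weight \<gamma> q = 1" if "\<gamma> \<in> M2 F" for \<gamma>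
    unfolding walk_weight_eq
  proof (intro prod.neutral ballI)
    fix e
    show "minus_one_to (\<gamma> $ e) ^ Suc (count_list (map fst q) e) = 1"
      using True that by (cases "e \<in> F") (auto simp: M2_eq minus_one_to_def simp del: power_Suc)
  qed
  then show ?thesis
    using True by (simp add: card_M2)
next
  case False
  then obtain e where e: "e \<in> F" "even (count_list (map fst q) e)"
    by blast
  have "axis e 1 \<in> M2 F"
    using e(1) by (auto simp: M2_eq axis_def)
  then have "(\<Sum>\<gamma>\<in>M2 F. walk_weight \<gamma> q) = (\<Sum>\<gamma>\<in>M2 F. walk_weight (\<gamma> + axis e 1) q)"
    by (rule sum_M2_shift[symmetric])
  also have "\<dots> = - (\<Sum>\<gamma>\<in>M2 F. walk_weight \<gamma> q)"
    using e(2) by (simp add: walk_weight_add walk_weight_axis sum_negf)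
  finally show ?thesis
    using False by simp
qed

definition twisted_trace ::
    "('e oriented \<Rightarrow> 'e oriented \<Rightarrow> bool) \<Rightarrow> bit ^ 'e::finite \<Rightarrow> real" where
  "twisted_trace R \<gamma> = (\<Sum>q\<in>closed_walks R CARD('e). walk_weight \<gamma> q)"

lemma twisted_trace_W1:
  "minus_one_to (sigma \<gamma>) * trace (mat_power (W1_mat G \<gamma>) CARD('e)) =
    twisted_trace (feeds_into G) (\<gamma> :: bit ^ 'e::finite)"
  by (simp add: W1_mat_eq_step_mat trace_step_mat_power twisted_trace_def walk_weight_def
      sum_distrib_left)

lemma twisted_trace_A:
  "minus_one_to (sigma \<gamma>) * trace (mat_power (A_mat G \<gamma>) CARD('e)) =
    twisted_trace (adjacent G) (\<gamma> :: bit ^ 'e::finite)"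
  by (simp add: trace_A_mat_power trace_step_mat_power twisted_trace_def walk_weight_def
      sum_distrib_left)

lemma closed_walks_mono:
  "(\<And>a b. R a b \<Longrightarrow> R' a b) \<Longrightarrow> closed_walks R k \<subseteq> closed_walks R' k"
  by (auto simp: closed_walks_def elim: successively_mono)

text \<open>Off the tree the parities are prescribed; on the tree they follow by comparison with an
  Eulerian circuit across the fundamental cut of each tree edge.\<close>

lemma closed_walk_odd_off_tree:
  fixes G :: "('v, 'e::finite) multigraph"
  assumes "is_eulerian G" "acyclic_on G T"
    and q: "q \<in> closed_walks (adjacent G) CARD('e)"
    and odd: "\<forall>e\<in>- T. odd (count_list (map fst q) e)"
  shows "eulerian_circuit G q"
proof -
  have odd_all: "odd (count_list (map fst q) e)" for e
  proof (cases "e \<in> T")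
    case True
    obtain p where p: "p \<in> closed_walks (adjacent G) CARD('e)" "\<And>e. count_list (map fst p) e = 1"
      using assms(1) by (auto simp: is_eulerian_def eulerian_circuit_iff)
    obtain d where d: "\<And>e'. e' \<in> T \<Longrightarrow> coboundary G d e' = (if e' = e then 1 else 0)"
      using acyclic_on_cut[OF assms(2) True] by metis
    \<comment> \<open>Both cut products are 1, and multiplying them adds the single passage of
      \<open>p\<close> to each exponent. Off \<open>T\<close> the exponent is then even, on the
      other tree edges the base is 1; only the factor of \<open>e\<close> survives.\<close>
    have "(1::real) = (\<Prod>e'\<in>UNIV. minus_one_to (coboundary G d e') ^ count_list (map fst p) e') *
        (\<Prod>e'\<in>UNIV. minus_one_to (coboundary G d e') ^ count_list (map fst q) e')"
      by (simp only: cut_crossings[OF p(1)] cut_crossings[OF q] mult_1)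
    also have "\<dots> = (\<Prod>e'\<in>UNIV. minus_one_to (coboundary G d e') ^ Suc (count_list (map fst q) e'))"
      by (simp only: p(2) prod.distrib[symmetric] power_Suc power_0 mult_1_right power_one_right)
    also have "\<dots> = (\<Prod>e'\<in>UNIV. if e' = e then (- 1) ^ Suc (count_list (map fst q) e') else 1)"
    proof (rule prod.cong)
      fix e'
      show "minus_one_to (coboundary G d e') ^ Suc (count_list (map fst q) e') =
          (if e' = e then (- 1) ^ Suc (count_list (map fst q) e') else 1)"
        using d[of e'] odd True by (cases "e' \<in> T") (auto simp: minus_one_to_def)
    qed simp
    finally have "(1::real) = (- 1) ^ Suc (count_list (map fst q) e)"
      by simp
    then show ?thesis
      by (cases "even (count_list (map fst q) e)") simp_all
  qed (use odd in auto)
  then have ge: "1 \<le> count_list (map fst q) e" for e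
    by (metis less_one linorder_not_le odd_pos order_less_irrefl)
  \<comment> \<open>Multiplicities that are at least 1 and sum to the number of edges all equal
    1.\<close>
  have "(\<Sum>e\<in>UNIV. count_list (map fst q) e) = (\<Sum>e\<in>(UNIV::'e set). 1)"
    using q by (simp add: sum_count_list_UNIV closed_walks_def)
  then have "count_list (map fst q) e = 1" for e
    using ge sum_mono_inv[of "\<lambda>_. 1" UNIV "count_list (map fst q)" e] by simp
  then show ?thesis
    using q by (simp add: eulerian_circuit_iff)
qed

lemma distinct_edges_no_backtracking:
  "distinct (map fst q) \<Longrightarrow> successively (\<lambda>a b. b \<noteq> inverse_edge a) q"
proof (induction q)
  case (Cons a q)
  have "hd q \<noteq> inverse_edge a" if "q \<noteq> []"
    using Cons.prems hd_in_set[OF that] by (metis distinct.simps(2) fst_conv imageI inverse_edge_def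
        list.set_map list.simps(9))
  then show ?case
    using Cons by (cases "q = []") (simp_all add: successively_Cons)
qed simp

lemma eulerian_circuit_feeds_into:
  fixes G :: "('v, 'e::finite) multigraph"
  assumes "eulerian_circuit G q"
  shows "q \<in> closed_walks (feeds_into G) CARD('e)"
proof -
  have len: "length q = CARD('e)" and adj: "successively (adjacent G) (q @ [hd q])"
    using assms by (auto simp: eulerian_circuit_iff closed_walks_def)
  have feeds: "successively (feeds_into G) r \<longleftrightarrow>
      successively (adjacent G) r \<and> successively (\<lambda>a b. b \<noteq> inverse_edge a) r" for r
    by (induction r) (auto simp: successively_Cons feeds_into_def adjacent_def)
  obtain a r where q: "q = a # r"
    using len by (cases q) auto
  have dist: "distinct (map fst q)"
    using assms by (rule eulerian_circuit_distinct)
  then have "successively (\<lambda>a b. b \<noteq> inverse_edge a) q"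
    by (rule distinct_edges_no_backtracking)
  \<comment> \<open>The closing step is treated separately. In a one-arc circuit it goes from
    \<open>a\<close> to itself, and an arc differs from its inverse even on a loop.\<close>
  moreover have "a \<noteq> inverse_edge (last q)"
  proof (cases "r = []")
    case False
    then have "fst (last q) \<in> fst ` set r"
      by (simp add: q)
    then show ?thesis
      using dist by (auto simp: q inverse_edge_def)
  qed (auto simp: q inverse_edge_def prod_eq_iff)
  ultimately have "successively (\<lambda>a b. b \<noteq> inverse_edge a) (q @ [hd q])"
    unfolding successively_append_iff by (simp add: q)
  then show ?thesis
    using len adj feeds by (simp add: closed_walks_def)
qed

text \<open>After exchanging the sums, the character sum keeps exactly the walks odd off the tree.
  The upper bound on \<open>R\<close> makes these Eulerian circuits; the lower bound ensures that no
  circuit is lost.\<close>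

lemma sum_twisted_trace:
  fixes G :: "('v, 'e::finite) multigraph"
  assumes "is_eulerian G" "acyclic_on G T"
    and R: "\<And>a b. R a b \<Longrightarrow> adjacent G a b" "\<And>a b. feeds_into G a b \<Longrightarrow> R a b"
  shows "(\<Sum>\<gamma>\<in>M2 (- T). twisted_trace R \<gamma>) = 2 ^ card (- T) * real (card {q. eulerian_circuit G q})"
proof -
  have "{q \<in> closed_walks R CARD('e). \<forall>e\<in>- T. odd (count_list (map fst q) e)} = {q. eulerian_circuit G q}"
    (is "?L = ?E")
  proof (intro equalityI subsetI)
    fix q assume "q \<in> ?L"
    then have "q \<in> closed_walks (adjacent G) CARD('e)" "\<forall>e\<in>- T. odd (count_list (map fst q) e)"
      using closed_walks_mono[of R "adjacent G" "CARD('e)"] R(1) by blast+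
    then show "q \<in> ?E"
      using closed_walk_odd_off_tree[OF assms(1,2)] by simp
  next
    fix q assume "q \<in> ?E"
    then have q: "eulerian_circuit G q"
      by simp
    have "q \<in> closed_walks R CARD('e)"
      using eulerian_circuit_feeds_into[OF q] closed_walks_mono[of "feeds_into G" R "CARD('e)"] R(2)
      by blast
    moreover have "count_list (map fst q) e = 1" for e
      using q by (simp add: eulerian_circuit_iff)
    ultimately show "q \<in> ?L"
      by simp
  qed
  moreover have "(\<Sum>\<gamma>\<in>M2 (- T). twisted_trace R \<gamma>) =
      (\<Sum>q\<in>closed_walks R CARD('e). \<Sum>\<gamma>\<in>M2 (- T). walk_weight \<gamma> q)"
    unfolding twisted_trace_def by (rule sum.swap)
  ultimately show ?thesis
    by (simp add: sum_walk_weight sum.If_cases finite_closed_walks Int_def)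
qed

section \<open>Rotation classes of circuits\<close>

lemma closed_walks_rotate1:
  assumes "q \<in> closed_walks R k"
  shows "rotate1 q \<in> closed_walks R k"
proof (cases q)
  case (Cons a r)
  then show ?thesis
    using assms
    by (cases r)
       (auto simp: closed_walks_def successively_append_iff successively_Cons hd_append split: if_splits)
qed (use assms in auto)

lemma eulerian_circuit_rotate1:
  fixes G :: "('v, 'e::finite) multigraph"
  assumes "eulerian_circuit G q"
  shows "eulerian_circuit G (rotate1 q)"
proof -
  have "count_list (map fst (rotate1 q)) e = count_list (map fst q) e" for e
    by (cases q) auto
  then show ?thesis
    using assms closed_walks_rotate1 unfolding eulerian_circuit_iff by auto
qed

lemma eulerian_circuit_rotate:
  fixes G :: "('v, 'e::finite) multigraph"
  shows "eulerian_circuit G q \<Longrightarrow> eulerian_circuit G (rotate k q)"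
  by (induction k) (simp_all add: eulerian_circuit_rotate1)

lemma equiv_rotation_rel:
  fixes G :: "('v, 'e::finite) multigraph"
  shows "equiv {q. eulerian_circuit G q} (rotation_rel G)"
proof (rule equivI)
  show "sym (rotation_rel G)"
  proof (rule symI)
    fix p q assume "(p, q) \<in> rotation_rel G"
    then obtain k where k: "eulerian_circuit G p" "eulerian_circuit G q" "q = rotate k p"
      by (auto simp: rotation_rel_def)
    have "length p > 0"
      using k(1) by (simp add: eulerian_circuit_iff closed_walks_def)
    then have "rotate (length p - k mod length p) q = rotate ((length p - k mod length p + k) mod length p) p"
      unfolding k(3) rotate_rotate by (rule_tac rotate_conv_mod)
    also have "(length p - k mod length p + k) mod length p = 0"
      using \<open>length p > 0\<close>
      by (metis add.commute le_add_diff_inverse mod_add_left_eq mod_le_divisor mod_self)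
    finally show "(q, p) \<in> rotation_rel G"
      using k by (auto simp: rotation_rel_def intro!: exI[of _ "length p - k mod length p"])
  qed
  show "trans (rotation_rel G)"
    by (rule transI) (auto simp: rotation_rel_def rotate_rotate)
  show "refl_on {q. eulerian_circuit G q} (rotation_rel G)"
    by (auto simp: rotation_rel_def refl_on_def intro: exI[of _ 0])
qed (auto simp: rotation_rel_def)

text \<open>The arcs of a circuit are distinct, so its rotations by less than its length differ in
  their first arc, and each class has one member per edge.\<close>

lemma card_eulerian_circuits:
  fixes G :: "('v, 'e::finite) multigraph"
  shows "card {q. eulerian_circuit G q} = CARD('e) * ec G"
proof -
  let ?E = "{q. eulerian_circuit G q}"
  have card: "card (rotation_rel G `` {q}) = CARD('e)" if q: "eulerian_circuit G q" for q
  proof -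
    have len: "length q = CARD('e)"
      using q by (simp add: eulerian_circuit_iff closed_walks_def)
    have "distinct q"
      using eulerian_circuit_distinct[OF q] by (simp add: distinct_map)
    have "rotation_rel G `` {q} = (\<lambda>k. rotate k q) ` {..<CARD('e)}"
    proof (intro equalityI subsetI)
      fix p assume "p \<in> rotation_rel G `` {q}"
      then obtain k where "p = rotate k q"
        by (auto simp: rotation_rel_def)
      then have "p = rotate (k mod CARD('e)) q"
        using rotate_conv_mod[of k q] len by simp
      then show "p \<in> (\<lambda>k. rotate k q) ` {..<CARD('e)}"
        by (intro image_eqI) auto
    qed (use q eulerian_circuit_rotate in \<open>auto simp: rotation_rel_def\<close>)
    moreover have "inj_on (\<lambda>k. rotate k q) {..<CARD('e)}"
    proof (rule inj_onI)
      fix k l assume kl: "k \<in> {..<CARD('e)}" "l \<in> {..<CARD('e)}" "rotate k q = rotate l q"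
      then have "q ! k = q ! l"
        using hd_rotate_conv_nth[of q k] hd_rotate_conv_nth[of q l] len by fastforce
      then show "k = l"
        using \<open>distinct q\<close> kl len by (simp add: nth_eq_iff_index_eq)
    qed
    ultimately show ?thesis
      by (simp add: card_image)
  qed
  have "finite ?E"
    by (rule finite_subset[OF _ finite_closed_walks[of "adjacent G" "CARD('e)"]])
       (auto simp: eulerian_circuit_iff)
  have "CARD('e) * card (?E // rotation_rel G) = card (\<Union>(?E // rotation_rel G))"
  proof (rule card_partition)
    show "finite (?E // rotation_rel G)"
      using \<open>finite ?E\<close> by (simp add: quotient_def)
    show "finite (\<Union>(?E // rotation_rel G))"
      using \<open>finite ?E\<close> Union_quotient[OF equiv_rotation_rel] by metis
    show "card c = CARD('e)" if "c \<in> ?E // rotation_rel G" for c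
      using that card by (auto simp: quotient_def)
    show "c \<inter> c' = {}" if "c \<in> ?E // rotation_rel G" "c' \<in> ?E // rotation_rel G" "c \<noteq> c'" for c c'
      using quotient_disj[OF equiv_rotation_rel that(1,2)] that(3) by blast
  qed
  then show ?thesis
    by (simp add: ec_def Union_quotient[OF equiv_rotation_rel])
qed

section \<open>Symmetries\<close>

lemma carrier_Aut:
  "carrier (Aut G) = {(f, h). bij f \<and> bij h \<and> (\<forall>e. endpoints G (h e) = f ` endpoints G e)}"
  by (simp add: Aut_def)

lemma Bij_UNIV: "Bij UNIV = {f. bij f}"
  by (simp add: Bij_def)

lemma mult_Aut:
  "bij f \<Longrightarrow> bij h \<Longrightarrow> bij f' \<Longrightarrow> bij h' \<Longrightarrow> (f, h) \<otimes>\<^bsub>Aut G\<^esub> (f', h') = (f \<circ> f', h \<circ> h')"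
  by (simp add: Aut_def DirProd_def BijGroup_def Bij_UNIV compose_def fun_eq_iff)

lemma one_Aut: "\<one>\<^bsub>Aut G\<^esub> = (id, id)"
  by (simp add: Aut_def DirProd_def BijGroup_def fun_eq_iff)

lemma group_Aut: "group (Aut G)"
proof (rule groupI)
  fix x y assume "x \<in> carrier (Aut G)" "y \<in> carrier (Aut G)"
  then show "x \<otimes>\<^bsub>Aut G\<^esub> y \<in> carrier (Aut G)"
    by (cases x; cases y) (auto simp: carrier_Aut mult_Aut image_comp bij_comp)
next
  show "\<one>\<^bsub>Aut G\<^esub> \<in> carrier (Aut G)"
    by (simp add: carrier_Aut one_Aut)
next
  fix x y z assume "x \<in> carrier (Aut G)" "y \<in> carrier (Aut G)" "z \<in> carrier (Aut G)"
  then show "x \<otimes>\<^bsub>Aut G\<^esub> y \<otimes>\<^bsub>Aut G\<^esub> z = x \<otimes>\<^bsub>Aut G\<^esub> (y \<otimes>\<^bsub>Aut G\<^esub> z)"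
    by (cases x; cases y; cases z) (simp add: carrier_Aut mult_Aut bij_comp comp_assoc)
next
  fix x assume x: "x \<in> carrier (Aut G)"
  then show "\<one>\<^bsub>Aut G\<^esub> \<otimes>\<^bsub>Aut G\<^esub> x = x"
    by (cases x) (simp add: carrier_Aut one_Aut mult_Aut)
  obtain f h where fh: "x = (f, h)" "bij f" "bij h" "\<And>e. endpoints G (h e) = f ` endpoints G e"
    using x by (auto simp: carrier_Aut)
  have "endpoints G (inv_into UNIV h e) = inv_into UNIV f ` endpoints G e" for e
    using fh(4)[of "inv_into UNIV h e"] fh(2,3) by (simp add: bij_is_surj surj_f_inv_f image_comp bij_is_inj)
  then have "(inv_into UNIV f, inv_into UNIV h) \<in> carrier (Aut G)"
    using fh by (simp add: carrier_Aut bij_imp_bij_inv)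
  moreover have "(inv_into UNIV f, inv_into UNIV h) \<otimes>\<^bsub>Aut G\<^esub> x = \<one>\<^bsub>Aut G\<^esub>"
    using fh by (simp add: mult_Aut one_Aut bij_imp_bij_inv bij_is_inj)
  ultimately show "\<exists>y\<in>carrier (Aut G). y \<otimes>\<^bsub>Aut G\<^esub> x = \<one>\<^bsub>Aut G\<^esub>"
    by blast
qed

text \<open>Evaluating at the image edge avoids the inverse permutation, and reaches every
  coefficient since the permutation is onto.\<close>

lemma chain_action_nth: "bij (snd \<tau>) \<Longrightarrow> chain_action \<tau> \<gamma> $ snd \<tau> e = \<gamma> $ e"
  by (simp add: chain_action_def axis_def bij_is_inj inj_eq if_distrib[of "\<lambda>x. _ * x"] cong: if_cong)

lemma chain_action_comp:
  assumes "bij h" "bij h'"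
  shows "chain_action (f, h) \<circ> chain_action (f', h') = chain_action (f \<circ> f', h \<circ> h')"
proof (intro ext iffD2[OF vec_eq_iff] allI)
  fix \<gamma> :: "bit ^ 'a" and x
  obtain e where "x = h (h' e)"
    using assms by (metis bij_pointE)
  moreover have "chain_action (f, h) (chain_action (f', h') \<gamma>) $ h (h' e) = chain_action (f', h') \<gamma> $ h' e"
    using chain_action_nth[of "(f, h)"] assms by simp
  moreover have "chain_action (f', h') \<gamma> $ h' e = \<gamma> $ e"
    using chain_action_nth[of "(f', h')"] assms by simp
  moreover have "chain_action (f \<circ> f', h \<circ> h') \<gamma> $ h (h' e) = \<gamma> $ e"
    using chain_action_nth[of "(f \<circ> f', h \<circ> h')" \<gamma> e] assms by (simp add: bij_comp)
  ultimately show "(chain_action (f, h) \<circ> chain_action (f', h')) \<gamma> $ x = chain_action (f \<circ> f', h \<circ> h') \<gamma> $ x"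
    by simp
qed

lemma chain_action_id: "chain_action (f, id) = id"
  by (simp add: fun_eq_iff chain_action_def basis_expansion)

lemma bij_chain_action:
  assumes "bij h"
  shows "bij (chain_action (f, h))"
proof (rule o_bij)
  show "chain_action (f, inv_into UNIV h) \<circ> chain_action (f, h) = id"
    using assms by (simp add: chain_action_comp bij_imp_bij_inv bij_is_inj chain_action_id)
  show "chain_action (f, h) \<circ> chain_action (f, inv_into UNIV h) = id"
    using assms
    by (simp add: chain_action_comp bij_imp_bij_inv bij_is_surj surj_iff[THEN iffD1] chain_action_id)
qed

section \<open>Permutation groups of the chain space\<close>

lemma mult_BijGroup_UNIV: "bij f \<Longrightarrow> bij g \<Longrightarrow> f \<otimes>\<^bsub>BijGroup UNIV\<^esub> g = f \<circ> g"
  by (simp add: BijGroup_def Bij_UNIV compose_def fun_eq_iff)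

lemma one_BijGroup_UNIV: "\<one>\<^bsub>BijGroup UNIV\<^esub> = id"
  by (simp add: BijGroup_def fun_eq_iff)

lemma carrier_BijGroup_UNIV: "carrier (BijGroup UNIV) = {f. bij f}"
  by (simp add: BijGroup_def Bij_UNIV)

lemma inv_BijGroup_UNIV: "bij f \<Longrightarrow> inv\<^bsub>BijGroup UNIV\<^esub> f = inv_into UNIV f"
  by (simp add: inv_BijGroup Bij_UNIV fun_eq_iff)

lemma chain_action_hom:
  "chain_action \<in> hom (Aut G) (BijGroup (UNIV :: (bit ^ 'e::finite) set))"
  by (auto simp: hom_def carrier_Aut carrier_BijGroup_UNIV mult_Aut mult_BijGroup_UNIV
      bij_chain_action chain_action_comp)

lemma subgroup_perm_group:
  assumes "subgroup H (Aut G)"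
  shows "subgroup (perm_group H) (BijGroup (UNIV :: (bit ^ 'e::finite) set))"
proof -
  interpret group_hom "Aut G" "BijGroup (UNIV :: (bit ^ 'e) set)" chain_action
    by (intro group_hom.intro group_hom_axioms.intro group_Aut group_BijGroup chain_action_hom)
  show ?thesis
    unfolding perm_group_def by (rule subgroup_img_is_subgroup[OF assms])
qed

lemma bij_translation: "bij (\<lambda>\<gamma>. \<gamma> + (\<delta> :: bit ^ 'e))"
  by (rule o_bij[of "\<lambda>\<gamma>. \<gamma> + \<delta>"]) (simp_all add: fun_eq_iff chain_add_self)

lemma subgroup_perm_group_ext:
  assumes "subgroup H (Aut G)"
  shows "subgroup (perm_group_ext H \<delta>) (BijGroup (UNIV :: (bit ^ 'e::finite) set))"
  unfolding perm_group_ext_def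
proof (rule group.generate_is_subgroup[OF group_BijGroup])
  show "insert (\<lambda>\<gamma>. \<gamma> + \<delta>) (perm_group H) \<subseteq> carrier (BijGroup UNIV)"
    using subgroup.subset[OF subgroup_perm_group[OF assms]] bij_translation[of \<delta>]
    by (simp add: carrier_BijGroup_UNIV)
qed

lemma perm_group_ext_invariant:
  assumes H: "subgroup H (Aut G)"
    and inv_H: "\<And>\<tau> \<gamma>. \<tau> \<in> perm_group H \<Longrightarrow> F (\<tau> \<gamma>) = F \<gamma>"
    and inv_\<delta>: "\<And>\<gamma>. F (\<gamma> + \<delta>) = F \<gamma>"
    and \<tau>: "\<tau> \<in> perm_group_ext H \<delta>"
  shows "F (\<tau> \<gamma>) = F \<gamma>"
proof -
  let ?K = "insert (\<lambda>\<gamma>. \<gamma> + \<delta>) (perm_group H)"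
  have bij: "bij k" if "k \<in> perm_group_ext H \<delta>" for k
    using subgroup.subset[OF subgroup_perm_group_ext[OF H, of \<delta>]] that
    by (auto simp: carrier_BijGroup_UNIV)
  have gen: "F (k \<gamma>) = F \<gamma>" if "k \<in> ?K" for k \<gamma>
    using that inv_H inv_\<delta> by auto
  have "\<tau> \<in> generate (BijGroup UNIV) ?K"
    using \<tau> by (simp add: perm_group_ext_def)
  then show ?thesis
  proof (induction arbitrary: \<gamma>)
    case one
    show ?case
      by (simp add: one_BijGroup_UNIV)
  next
    case (incl k)
    then show ?case
      by (rule gen)
  next
    case (inv k)
    have k: "bij k"
      using bij generate.incl[OF inv, of "BijGroup UNIV"] by (simp add: perm_group_ext_def)
    \<comment> \<open>Invariance under the inverse is invariance under \<open>k\<close>, read at the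
      preimage of \<open>\<gamma>\<close>.\<close>
    have "F (k (inv_into UNIV k \<gamma>)) = F (inv_into UNIV k \<gamma>)"
      by (rule gen[OF inv])
    then show ?case
      using k by (simp add: inv_BijGroup_UNIV surj_f_inv_f[OF bij_is_surj])
  next
    case (eng k l)
    have "bij k" "bij l"
      using eng.hyps bij by (auto simp: perm_group_ext_def)
    then show ?case
      using eng.IH by (simp add: mult_BijGroup_UNIV)
  qed
qed

text \<open>An automorphism acts on unoriented edges; on loops its lift to oriented edges is a choice.\<close>

lemma Aut_lift:
  fixes G :: "('v, 'e) multigraph"
  assumes "(f, h) \<in> carrier (Aut G)"
  obtains \<phi> :: "'e oriented \<Rightarrow> 'e oriented" where "bij \<phi>" "\<And>a. fst (\<phi> a) = h (fst a)"
    "\<And>a. initial G (\<phi> a) = f (initial G a)" "\<And>a. terminal G (\<phi> a) = f (terminal G a)"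
    "\<And>a. \<phi> (inverse_edge a) = inverse_edge (\<phi> a)"
proof -
  have bij: "bij f" "bij h" and ends: "\<And>e. endpoints G (h e) = f ` endpoints G e"
    using assms by (auto simp: carrier_Aut)
  \<comment> \<open>\<open>keep e\<close> records whether the reference direction is respected;
    where it fails, \<open>\<phi>\<close> flips the orientation. On a loop it holds, so no flip is
    made.\<close>
  define keep where "keep e \<longleftrightarrow> G (h e) = (f (fst (G e)), f (snd (G e)))" for e
  define \<phi> :: "'e oriented \<Rightarrow> 'e oriented" where "\<phi> a = (h (fst a), snd a = keep (fst a))" for a
  have swap: "G (h e) = (f (snd (G e)), f (fst (G e)))" if "\<not> keep e" for e
    using ends[of e] that unfolding endpoints_def keep_def by (auto simp: doubleton_eq_iff prod_eq_iff)
  have "bij \<phi>"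
  proof (rule bijI)
    show "inj \<phi>"
      using bij(2) by (auto simp: inj_def \<phi>_def prod_eq_iff bij_def)
    show "surj \<phi>"
    proof (rule surjI)
      fix b :: "'e oriented"
      show "\<phi> (inv_into UNIV h (fst b), snd b = keep (inv_into UNIV h (fst b))) = b"
        using bij(2) by (auto simp: \<phi>_def prod_eq_iff bij_is_surj surj_f_inv_f)
    qed
  qed
  moreover have "initial G (\<phi> a) = f (initial G a)" "terminal G (\<phi> a) = f (terminal G a)" for a
    using swap[of "fst a"] by (auto simp: \<phi>_def initial_def terminal_def keep_def)
  ultimately show ?thesis
    using that[of \<phi>] by (auto simp: \<phi>_def inverse_edge_def)
qed

section \<open>Invariance of the signed traces\<close>

lemma sigma_chain_action: "bij h \<Longrightarrow> sigma (chain_action (f, h) \<gamma>) = sigma \<gamma>"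
  unfolding sigma_def
  using sum.reindex_bij_betw[of h UNIV UNIV "\<lambda>e. chain_action (f, h) \<gamma> $ e"]
    chain_action_nth[of "(f, h)" \<gamma>] by simp

text \<open>Moving walk and chain together preserves the weight, and \<open>map \<phi>\<close>
  permutes the closed walks.\<close>

lemma twisted_trace_chain_action:
  fixes G :: "('v, 'e::finite) multigraph"
  assumes "bij h" "bij \<phi>" and edge: "\<And>a. fst (\<phi> a) = h (fst a)"
    and R: "\<And>a b. R (\<phi> a) (\<phi> b) \<longleftrightarrow> R a b"
  shows "twisted_trace R (chain_action (f, h) \<gamma>) = twisted_trace R \<gamma>"
proof -
  have weight: "walk_weight (chain_action (f, h) \<gamma>) (map \<phi> q) = walk_weight \<gamma> q" for q
    using assms(1) chain_action_nth[of "(f, h)" \<gamma>]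
    by (simp add: walk_weight_def sigma_chain_action chi_walk_def chi_def[abs_def] comp_def edge)
  have closed: "map \<phi> q \<in> closed_walks R k \<longleftrightarrow> q \<in> closed_walks R k" if "k > 0" for q k
  proof (cases "q = []")
    case False
    then have "map \<phi> q @ [hd (map \<phi> q)] = map \<phi> (q @ [hd q])"
      by (simp add: hd_map)
    then show ?thesis
      unfolding closed_walks_def by (simp only: mem_Collect_eq successively_map length_map R)
  qed (use that in \<open>simp add: closed_walks_def\<close>)
  have "map \<phi> (map (inv_into UNIV \<phi>) q) = q" "map (inv_into UNIV \<phi>) (map \<phi> q) = q" for q
    using assms(2) by (simp_all add: comp_def bij_is_surj surj_f_inv_f bij_is_inj)
  then show ?thesis
    unfolding twisted_trace_def
    by (intro sum.reindex_bij_witness[of _ "map \<phi>" "map (inv_into UNIV \<phi>)"])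
       (metis closed weight zero_less_card_finite)+
qed

text \<open>The lift to arcs carries ends along the injective vertex map and commutes with
  inversion, so it preserves both walk relations.\<close>

lemma twisted_trace_perm_group:
  fixes G :: "('v, 'e::finite) multigraph"
  assumes "subgroup H (Aut G)" "\<tau> \<in> perm_group H" "R \<in> {adjacent G, feeds_into G}"
  shows "twisted_trace R (\<tau> \<gamma>) = twisted_trace R \<gamma>"
proof -
  obtain f h where fh: "(f, h) \<in> carrier (Aut G)" "\<tau> = chain_action (f, h)"
    using assms(2) subgroup.subset[OF assms(1)] by (auto simp: perm_group_def)
  have bij: "bij f" "bij h"
    using fh(1) by (auto simp: carrier_Aut)
  obtain \<phi> :: "'e oriented \<Rightarrow> 'e oriented" where \<phi>: "bij \<phi>" "\<And>a. fst (\<phi> a) = h (fst a)"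
    "\<And>a. initial G (\<phi> a) = f (initial G a)" "\<And>a. terminal G (\<phi> a) = f (terminal G a)"
    "\<And>a. \<phi> (inverse_edge a) = inverse_edge (\<phi> a)"
    using Aut_lift[OF fh(1)] by metis
  have "R (\<phi> a) (\<phi> b) \<longleftrightarrow> R a b" for a b
  proof -
    have "adjacent G (\<phi> a) (\<phi> b) \<longleftrightarrow> adjacent G a b"
      by (simp only: adjacent_def \<phi>(3,4) inj_eq[OF bij_is_inj[OF bij(1)]])
    moreover have "feeds_into G (\<phi> a) (\<phi> b) \<longleftrightarrow> feeds_into G a b"
      by (simp only: feeds_into_def \<phi>(3,4) \<phi>(5)[symmetric] inj_eq[OF bij_is_inj[OF bij(1)]]
          inj_eq[OF bij_is_inj[OF \<phi>(1)]])
    ultimately show ?thesis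
      using assms(3) by auto
  qed
  then show ?thesis
    unfolding fh(2) by (rule twisted_trace_chain_action[OF bij(2) \<phi>(1,2)])
qed

text \<open>
  The canonical element is the sum of all edges plus a coboundary.  Both have weight one: the
  coboundary because closed walks and Eulerian circuits cross every cut evenly, and the sum of all
  edges because the walk has as many steps as there are edges.
\<close>

lemma twisted_trace_add_canonical:
  fixes G :: "('v, 'e::finite) multigraph"
  assumes "is_eulerian G" "is_spanning_tree G T" and R: "\<And>a b. R a b \<Longrightarrow> adjacent G a b"
  shows "twisted_trace R (\<gamma> + canonical G T) = twisted_trace R \<gamma>"
proof -
  obtain p where p: "p \<in> closed_walks (adjacent G) CARD('e)" "\<And>e. count_list (map fst p) e = 1"
    using assms(1) by (auto simp: is_eulerian_def eulerian_circuit_iff)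
  obtain d where d: "\<And>e. canonical G T $ e = 1 + coboundary G d e"
    using canonical_eq_coboundary[OF assms(2)] by metis
  have "walk_weight (canonical G T) q = 1" if "q \<in> closed_walks R CARD('e)" for q
  proof -
    have q: "q \<in> closed_walks (adjacent G) CARD('e)"
      using that closed_walks_mono[of R "adjacent G"] R by blast
    let ?N = "\<lambda>r. count_list (map fst r)"
    let ?c = "\<lambda>e. minus_one_to (coboundary G d e)"
    \<comment> \<open>Since \<open>p\<close> uses each edge once, \<open>Suc (?N q e)\<close> is
      \<open>?N p e + ?N q e\<close>, and the coboundary part becomes two cut products equal to 1.
      The remaining power of -1 has twice the number of edges as exponent.\<close>
    have "walk_weight (canonical G T) q =
        (\<Prod>e\<in>UNIV. (- 1) ^ Suc (?N q e)) * ((\<Prod>e\<in>UNIV. ?c e ^ ?N p e) * (\<Prod>e\<in>UNIV. ?c e ^ ?N q e))"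
      unfolding walk_weight_eq d minus_one_to_add p(2) power_mult_distrib prod.distrib[symmetric]
      by (intro prod.cong refl) (simp only: minus_one_to_1 power_Suc power_one_right)
    also have "\<dots> = (\<Prod>e\<in>(UNIV::'e set). (- 1)) * (\<Prod>e\<in>UNIV. (- 1) ^ ?N q e)"
      by (simp only: cut_crossings[OF p(1)] cut_crossings[OF q] power_Suc prod.distrib mult_1_right)
    also have "\<dots> = (- 1) ^ (CARD('e) + (\<Sum>e\<in>UNIV. ?N q e))"
      by (simp add: power_add power_sum)
    also have "(\<Sum>e\<in>UNIV. ?N q e) = CARD('e)"
      using q by (simp add: sum_count_list_UNIV closed_walks_def)
    finally show ?thesis
      by simp
  qed
  then show ?thesis
    by (simp add: twisted_trace_def walk_weight_add)
qed

text \<open>The signed summand \<open>F\<close> is constant on each class, so size times value at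
  any representative is the sum over the class, and the classes partition \<open>S\<close>.\<close>

lemma class_sum_eq_sum:
  fixes S :: "(bit ^ 'e::finite) set"
  assumes K: "subgroup K (BijGroup UNIV)" and "finite S"
    and rep: "\<And>c. c \<noteq> {} \<Longrightarrow> rep c \<in> c"
    and F: "\<And>\<gamma>. minus_one_to (sigma \<gamma>) * t \<gamma> = F \<gamma>"
    and inv: "\<And>\<tau> \<gamma>. \<tau> \<in> K \<Longrightarrow> F (\<tau> \<gamma>) = F \<gamma>"
  shows "class_sum rep t (orbit_classes S K) = (\<Sum>\<gamma>\<in>S. F \<gamma>)"
proof -
  have bij: "bij \<tau>" if "\<tau> \<in> K" for \<tau>
    using subgroup.subset[OF K] that by (auto simp: carrier_BijGroup_UNIV)
  have id: "id \<in> K"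
    using subgroup.one_closed[OF K] by (simp add: one_BijGroup_UNIV)
  have comp: "\<sigma> \<circ> \<tau> \<in> K" if "\<sigma> \<in> K" "\<tau> \<in> K" for \<sigma> \<tau>
    using subgroup.m_closed[OF K that] bij that by (simp add: mult_BijGroup_UNIV)
  have inv_K: "inv_into UNIV \<tau> \<in> K" if "\<tau> \<in> K" for \<tau>
    using subgroup.m_inv_closed[OF K that] bij[OF that] by (simp add: inv_BijGroup_UNIV)
  \<comment> \<open>The orbit relation restricted to \<open>S\<close> is an equivalence even when
    \<open>S\<close> is not invariant under \<open>K\<close>; its classes are the intersections of
    orbits with \<open>S\<close>.\<close>
  define r where "r = {(x, y). x \<in> S \<and> y \<in> S \<and> (\<exists>\<tau>\<in>K. y = \<tau> x)}"
  have r: "equiv S r"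
  proof (rule equivI)
    show "refl_on S r"
      using id by (auto simp: r_def refl_on_def intro!: bexI[of _ id])
    show "sym r"
    proof (rule symI)
      fix x y assume "(x, y) \<in> r"
      then obtain \<tau> where \<tau>: "x \<in> S" "y \<in> S" "\<tau> \<in> K" "y = \<tau> x"
        by (auto simp: r_def)
      then have "x = inv_into UNIV \<tau> y"
        using bij by (simp add: bij_is_inj)
      then show "(y, x) \<in> r"
        using \<tau> inv_K by (auto simp: r_def)
    qed
    show "trans r"
    proof (rule transI)
      fix x y z assume "(x, y) \<in> r" "(y, z) \<in> r"
      then obtain \<sigma> \<tau> where "x \<in> S" "z \<in> S" "\<tau> \<in> K" "\<sigma> \<in> K" "z = (\<sigma> \<circ> \<tau>) x"
        by (auto simp: r_def)
      then show "(x, z) \<in> r"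
        using comp[of \<sigma> \<tau>] by (auto simp: r_def intro!: bexI[of _ "\<sigma> \<circ> \<tau>"])
    qed
  qed (auto simp: r_def)
  have quot: "orbit_classes S K = S // r"
    by (auto simp: orbit_classes_def orbit_class_def quotient_def r_def)
  have class_finite: "finite c" if "c \<in> S // r" for c
    using that \<open>finite S\<close> Union_quotient[OF r] by (metis Union_upper finite_subset)
  have "class_sum rep t (S // r) = (\<Sum>c\<in>S // r. \<Sum>\<gamma>\<in>c. F \<gamma>)"
    unfolding class_sum_def
  proof (rule sum.cong)
    fix c assume c: "c \<in> S // r"
    then have "rep c \<in> c"
      using rep in_quotient_imp_non_empty[OF r] by blast
    then have "F \<gamma> = F (rep c)" if "\<gamma> \<in> c" for \<gamma>
      using in_quotient_imp_in_rel[OF r c, of "rep c" \<gamma>] that inv by (auto simp: r_def)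
    then show "real (card c) * minus_one_to (sigma (rep c)) * t (rep c) = (\<Sum>\<gamma>\<in>c. F \<gamma>)"
      by (simp add: mult.assoc F)
  qed simp
  also have "\<dots> = (\<Sum>\<gamma>\<in>\<Union>(S // r). F \<gamma>)"
    using class_finite quotient_disj[OF r] by (subst sum.Union_disjoint) auto
  finally show ?thesis
    by (simp add: quot Union_quotient[OF r])
qed

section \<open>Assembly of the six formulas\<close>

theorem theorem6p15:
  fixes G :: "('v::finite, 'e::finite) multigraph"
    and T :: "'e set"
    and H :: "(('v \<Rightarrow> 'v) \<times> ('e \<Rightarrow> 'e)) set"
    and S :: "nat \<Rightarrow> (bit ^ 'e) set"
    and rep :: "(bit ^ 'e) set \<Rightarrow> bit ^ 'e"
    and i :: nat
  assumes connected: "connected_on G UNIV"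
    and non_bipartite: "\<not> is_bipartite G"
    and eulerian: "is_eulerian G"
    and tree: "is_spanning_tree G T"
    and H: "subgroup H (Aut G)"
    and partition: "S 1 \<union> S 2 = M2 (- T)" "S 1 \<inter> S 2 = {}"
    and split: "\<forall>\<gamma>\<in>M2 (- T). \<gamma> \<noteq> \<gamma> + canonical G T \<and>
                  (\<gamma> \<in> S 1 \<longleftrightarrow> \<gamma> + canonical G T \<in> S 2)"
    and rep: "\<And>c. c \<noteq> {} \<Longrightarrow> rep c \<in> c"
    and i: "i \<in> {1, 2}"
  shows "real (ec G) = 1 / (real CARD('e) * 2 powi (genus G - 1)) *
           class_sum rep (\<lambda>\<gamma>. trace (mat_power (W1_mat G \<gamma>) CARD('e)))
             (orbit_classes (S i) (perm_group H)) \<and>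
         real (ec G) = 1 / (real CARD('e) * 2 powi (genus G - 1)) *
           class_sum rep (\<lambda>\<gamma>. trace (mat_power (A_mat G \<gamma>) CARD('e)))
             (orbit_classes (S i) (perm_group H)) \<and>
         real (ec G) = 1 / (real CARD('e) * 2 powi (genus G)) *
           class_sum rep (\<lambda>\<gamma>. trace (mat_power (W1_mat G \<gamma>) CARD('e)))
             (orbit_classes (M2 (- T)) (perm_group_ext H (canonical G T))) \<and>
         real (ec G) = 1 / (real CARD('e) * 2 powi (genus G)) *
           class_sum rep (\<lambda>\<gamma>. trace (mat_power (A_mat G \<gamma>) CARD('e)))
             (orbit_classes (M2 (- T)) (perm_group_ext H (canonical G T))) \<and>
         real (ec G) = 1 / (real CARD('e) * 2 powi (genus G - 1)) *
           class_sum rep (\<lambda>\<gamma>. trace (mat_power (W1_mat G \<gamma>) CARD('e)))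
             (orbit_classes (S i) (perm_group_ext H (canonical G T))) \<and>
         real (ec G) = 1 / (real CARD('e) * 2 powi (genus G - 1)) *
           class_sum rep (\<lambda>\<gamma>. trace (mat_power (A_mat G \<gamma>) CARD('e)))
             (orbit_classes (S i) (perm_group_ext H (canonical G T)))"
proof -
  let ?\<delta> = "canonical G T"
  have "acyclic_on G T"
    using tree by (simp add: is_spanning_tree_def)
  \<comment> \<open>A spanning tree has one edge fewer than there are vertices, so the genus counts
    the edges outside it.\<close>
  have genus: "genus G = int (card (- T))"
  proof -
    have "CARD('e) = card T + card (- T)"
      using card_Un_disjoint[of T "- T"] by (simp add: Compl_partition)
    then show ?thesis
      by (simp add: genus_def card_spanning_tree[OF tree])
  qed
  have fin: "finite (M2 (- T))" "finite (S i)"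
    using finite_M2[of "- T"] partition(1) i by (auto intro: finite_subset)
  have \<delta>: "?\<delta> \<in> M2 (- T)"
    by (simp add: M2_eq canonical_def)
  have S_to: "\<gamma> + ?\<delta> \<in> S 2" if "\<gamma> \<in> S 1" for \<gamma>
    using split partition(1) that by blast
  \<comment> \<open>The condition \<open>split\<close> is applied to
    \<open>\<gamma> + ?\<delta>\<close>, whose translate is \<open>\<gamma>\<close> again.\<close>
  have S_from: "\<gamma> + ?\<delta> \<in> S 1" if "\<gamma> \<in> S 2" for \<gamma>
  proof -
    have "\<gamma> + ?\<delta> \<in> M2 (- T)"
      using that partition(1) \<delta> by (intro M2_add) auto
    then show ?thesis
      using split that by (metis chain_add_self)
  qed
  have sums: "(\<Sum>\<gamma>\<in>M2 (- T). twisted_trace R \<gamma>) = real CARD('e) * 2 powi genus G * real (ec G)"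
      "(\<Sum>\<gamma>\<in>S i. twisted_trace R \<gamma>) = real CARD('e) * 2 powi (genus G - 1) * real (ec G)"
    if R: "R \<in> {adjacent G, feeds_into G}" for R
  proof -
    have R': "R a b \<Longrightarrow> adjacent G a b" "feeds_into G a b \<Longrightarrow> R a b" for a b
      using R by (auto simp: adjacent_def feeds_into_def)
    show all: "(\<Sum>\<gamma>\<in>M2 (- T). twisted_trace R \<gamma>) = real CARD('e) * 2 powi genus G * real (ec G)"
      by (simp add: sum_twisted_trace[OF eulerian \<open>acyclic_on G T\<close> R'] genus card_eulerian_circuits)
    \<comment> \<open>Translation by the canonical element exchanges \<open>S 1\<close> and
      \<open>S 2\<close> and preserves the summand, so each carries half of the total.\<close>
    have "(\<Sum>\<gamma>\<in>S 1. twisted_trace R \<gamma>) = (\<Sum>\<gamma>\<in>S 2. twisted_trace R \<gamma>)"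
      by (rule sum.reindex_bij_witness[of _ "\<lambda>\<gamma>. \<gamma> + ?\<delta>" "\<lambda>\<gamma>. \<gamma> + ?\<delta>"])
         (simp_all only: chain_add_self S_to S_from twisted_trace_add_canonical[OF eulerian tree R'(1)])
    moreover have "(\<Sum>\<gamma>\<in>M2 (- T). twisted_trace R \<gamma>) =
        (\<Sum>\<gamma>\<in>S 1. twisted_trace R \<gamma>) + (\<Sum>\<gamma>\<in>S 2. twisted_trace R \<gamma>)"
      unfolding partition(1)[symmetric]
      using finite_M2[of "- T"] partition by (intro sum.union_disjoint) (auto intro: finite_subset)
    ultimately have "2 * (\<Sum>\<gamma>\<in>S i. twisted_trace R \<gamma>) = (\<Sum>\<gamma>\<in>M2 (- T). twisted_trace R \<gamma>)"
      using i by auto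
    then show "(\<Sum>\<gamma>\<in>S i. twisted_trace R \<gamma>) = real CARD('e) * 2 powi (genus G - 1) * real (ec G)"
      unfolding all by (simp add: power_int_diff)
  qed
  have H_inv: "twisted_trace R (\<tau> \<gamma>) = twisted_trace R \<gamma>"
    if "R \<in> {adjacent G, feeds_into G}" "\<tau> \<in> perm_group H" for R \<tau> \<gamma>
    by (rule twisted_trace_perm_group[OF H that(2,1)])
  have ext_inv: "twisted_trace R (\<tau> \<gamma>) = twisted_trace R \<gamma>"
    if R: "R \<in> {adjacent G, feeds_into G}" and \<tau>: "\<tau> \<in> perm_group_ext H ?\<delta>" for R \<tau> \<gamma>
  proof (rule perm_group_ext_invariant[OF H _ _ \<tau>])
    show "twisted_trace R (\<tau> \<gamma>) = twisted_trace R \<gamma>" if "\<tau> \<in> perm_group H" for \<tau> \<gamma>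
      by (rule H_inv[OF R that])
    show "twisted_trace R (\<gamma> + ?\<delta>) = twisted_trace R \<gamma>" for \<gamma>
      using R by (intro twisted_trace_add_canonical[OF eulerian tree])
        (auto simp: adjacent_def feeds_into_def)
  qed
  have formula: "class_sum rep t (orbit_classes (S i) (perm_group H)) =
          real CARD('e) * 2 powi (genus G - 1) * real (ec G)"
      "class_sum rep t (orbit_classes (M2 (- T)) (perm_group_ext H ?\<delta>)) =
          real CARD('e) * 2 powi genus G * real (ec G)"
      "class_sum rep t (orbit_classes (S i) (perm_group_ext H ?\<delta>)) =
          real CARD('e) * 2 powi (genus G - 1) * real (ec G)"
    if R: "R \<in> {adjacent G, feeds_into G}"
      and t: "\<And>\<gamma>. minus_one_to (sigma \<gamma>) * t \<gamma> = twisted_trace R \<gamma>" for R t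
  proof -
    have cs: "class_sum rep t (orbit_classes X K) = (\<Sum>\<gamma>\<in>X. twisted_trace R \<gamma>)"
      if "subgroup K (BijGroup UNIV)" "finite X"
        "\<And>\<tau> \<gamma>. \<tau> \<in> K \<Longrightarrow> twisted_trace R (\<tau> \<gamma>) = twisted_trace R \<gamma>" for X K
      using that rep t by (intro class_sum_eq_sum) auto
    show "class_sum rep t (orbit_classes (S i) (perm_group H)) =
        real CARD('e) * 2 powi (genus G - 1) * real (ec G)"
      unfolding sums(2)[OF R, symmetric]
      by (rule cs[OF subgroup_perm_group[OF H] fin(2)]) (rule H_inv[OF R])
    show "class_sum rep t (orbit_classes (M2 (- T)) (perm_group_ext H ?\<delta>)) =
        real CARD('e) * 2 powi genus G * real (ec G)"
      unfolding sums(1)[OF R, symmetric]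
      by (rule cs[OF subgroup_perm_group_ext[OF H] fin(1)]) (rule ext_inv[OF R])
    show "class_sum rep t (orbit_classes (S i) (perm_group_ext H ?\<delta>)) =
        real CARD('e) * 2 powi (genus G - 1) * real (ec G)"
      unfolding sums(2)[OF R, symmetric]
      by (rule cs[OF subgroup_perm_group_ext[OF H] fin(2)]) (rule ext_inv[OF R])
  qed
  \<comment> \<open>Unification with the identities for the two matrices selects \<open>R\<close>
    and \<open>t\<close>.\<close>
  note W = formula[OF _ twisted_trace_W1[of _ G], simplified]
  note A = formula[OF _ twisted_trace_A[of _ G], simplified]
  show ?thesis
    unfolding W A by simp
qed

end
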